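(* Let $G$ be a MIF group. Then $G$ is contained in a maximal discrete subgroup of $\mathrm{PU}(LG)$.
   Context: A mixed identity for a group $G$ is a word $w\in\mathbb Z*G=\langle G,t\rangle$ in one variable $t$ with coefficients in $G$ which evaluates to the identity whenever any element of $G$ is substituted for $t$. $G$ is mixed identity free (MIF) if it satisfies no non-trivial mixed identity, i.e. for every $w\in(\mathbb Z*G)\setminus\{1\}$ there is $g\in G$ with $w(g)\neq1$. $LG$ is the group von Neumann algebra of $G$ with its canonical trace $\tau$; $\|x\|_2=\tau(x^*x)^{1/2}$. $\mathrm{U}(LG)$ is its unitary group and $\mathrm{PU}(LG)=\mathrm{U}(LG)/S^1$ its projective unitary group. For MIF $G$, the left regular representation gives a natural inclusion $G\subset \mathrm{PU}(LG)$. The topology on $\mathrm{PU}(LG)$ is given by the metric $d(u,v)=\bar\ell(u^{*}v)$, where $\bar\ell(u)=\inf_{|\lambda|=1}\|\lambda-u\|_2$. A maximal discrete subgroup is a discrete subgroup that is not properly contained in any other discrete subgroup. *)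

theory Defs
  imports "HOL-Analysis.Analysis" "HOL-Algebra.Elementary_Groups"
begin

section \<open>Free products and mixed identities\<close>

text \<open>The free product \<open>G * H\<close>, realised on reduced words: lists of non-identity elements
  alternately taken from \<open>G\<close> (tag \<open>Inl\<close>) and \<open>H\<close> (tag \<open>Inr\<close>).\<close>

definition reduced_words :: "('a, 'm) monoid_scheme \<Rightarrow> ('b, 'n) monoid_scheme \<Rightarrow> ('a + 'b) list set"
  where "reduced_words G H =
    {ws. set ws \<subseteq> Inl ` (carrier G - {\<one>\<^bsub>G\<^esub>}) \<union> Inr ` (carrier H - {\<one>\<^bsub>H\<^esub>}) \<and>
         successively (\<lambda>s t. isl s \<noteq> isl t) ws}"

text \<open>The product of a single syllable with a reduced word.\<close>

fun push_syllable ::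
    "('a, 'm) monoid_scheme \<Rightarrow> ('b, 'n) monoid_scheme \<Rightarrow> 'a + 'b \<Rightarrow> ('a + 'b) list \<Rightarrow> ('a + 'b) list"
  where
  "push_syllable G H (Inl a) (Inl b # ws) =
     (if a \<otimes>\<^bsub>G\<^esub> b = \<one>\<^bsub>G\<^esub> then ws else Inl (a \<otimes>\<^bsub>G\<^esub> b) # ws)"
| "push_syllable G H (Inr a) (Inr b # ws) =
     (if a \<otimes>\<^bsub>H\<^esub> b = \<one>\<^bsub>H\<^esub> then ws else Inr (a \<otimes>\<^bsub>H\<^esub> b) # ws)"
| "push_syllable G H (Inl a) ws = (if a = \<one>\<^bsub>G\<^esub> then ws else Inl a # ws)"
| "push_syllable G H (Inr a) ws = (if a = \<one>\<^bsub>H\<^esub> then ws else Inr a # ws)"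

definition free_product ::
    "('a, 'm) monoid_scheme \<Rightarrow> ('b, 'n) monoid_scheme \<Rightarrow> ('a + 'b) list monoid"
  where "free_product G H =
    \<lparr>carrier = reduced_words G H, mult = (\<lambda>us vs. foldr (push_syllable G H) us vs), one = []\<rparr>"

text \<open>The value \<open>w(g)\<close> of \<open>w \<in> \<int> * G\<close>; the syllable \<open>Inl n\<close> stands for \<open>t\<^sup>n\<close>.\<close>

definition eval_syllable :: "('a, 'm) monoid_scheme \<Rightarrow> 'a \<Rightarrow> int + 'a \<Rightarrow> 'a"
  where "eval_syllable G g s = (case s of Inl n \<Rightarrow> g [^]\<^bsub>G\<^esub> n | Inr h \<Rightarrow> h)"

definition eval_word :: "('a, 'm) monoid_scheme \<Rightarrow> (int + 'a) list \<Rightarrow> 'a \<Rightarrow> 'a"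
  where "eval_word G w g = foldr (\<lambda>s x. eval_syllable G g s \<otimes>\<^bsub>G\<^esub> x) w \<one>\<^bsub>G\<^esub>"

definition mixed_identity :: "('a, 'm) monoid_scheme \<Rightarrow> (int + 'a) list \<Rightarrow> bool"
  where "mixed_identity G w \<longleftrightarrow>
    w \<in> carrier (free_product integer_group G) \<and> (\<forall>g\<in>carrier G. eval_word G w g = \<one>\<^bsub>G\<^esub>)"

definition mixed_identity_free :: "('a, 'm) monoid_scheme \<Rightarrow> bool"
  where "mixed_identity_free G \<longleftrightarrow>
    (\<forall>w. mixed_identity G w \<longrightarrow> w = \<one>\<^bsub>free_product integer_group G\<^esub>)"


section \<open>Bounded operators on the Hilbert space of a group\<close>

text \<open>Elements of \<open>\<ell>\<^sup>2(G)\<close> vanish off the carrier, and operators are extensional functions, so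
  that equality of vectors and of operators is equality in HOL.\<close>

definition ell2 :: "('a, 'm) monoid_scheme \<Rightarrow> ('a \<Rightarrow> complex) set"
  where "ell2 G = {f. (\<forall>x. x \<notin> carrier G \<longrightarrow> f x = 0) \<and>
                      (\<lambda>x. (cmod (f x))\<^sup>2) summable_on carrier G}"

definition ell2_inner :: "('a, 'm) monoid_scheme \<Rightarrow> ('a \<Rightarrow> complex) \<Rightarrow> ('a \<Rightarrow> complex) \<Rightarrow> complex"
  where "ell2_inner G f g = (\<Sum>\<^sub>\<infinity>x\<in>carrier G. f x * cnj (g x))"

definition ell2_norm :: "('a, 'm) monoid_scheme \<Rightarrow> ('a \<Rightarrow> complex) \<Rightarrow> real"
  where "ell2_norm G f = sqrt (\<Sum>\<^sub>\<infinity>x\<in>carrier G. (cmod (f x))\<^sup>2)"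

type_synonym 'a ell2_op = "('a \<Rightarrow> complex) \<Rightarrow> ('a \<Rightarrow> complex)"

definition bounded_ops :: "('a, 'm) monoid_scheme \<Rightarrow> 'a ell2_op set"
  where "bounded_ops G = {T \<in> ell2 G \<rightarrow>\<^sub>E ell2 G.
    (\<forall>f\<in>ell2 G. \<forall>g\<in>ell2 G. T (\<lambda>x. f x + g x) = (\<lambda>x. T f x + T g x)) \<and>
    (\<forall>c. \<forall>f\<in>ell2 G. T (\<lambda>x. c * f x) = (\<lambda>x. c * T f x)) \<and>
    (\<exists>C. \<forall>f\<in>ell2 G. ell2_norm G (T f) \<le> C * ell2_norm G f)}"

abbreviation op_compose :: "('a, 'm) monoid_scheme \<Rightarrow> 'a ell2_op \<Rightarrow> 'a ell2_op \<Rightarrow> 'a ell2_op"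
  where "op_compose G \<equiv> compose (ell2 G)"

definition op_diff :: "('a, 'm) monoid_scheme \<Rightarrow> 'a ell2_op \<Rightarrow> 'a ell2_op \<Rightarrow> 'a ell2_op"
  where "op_diff G S T = (\<lambda>f\<in>ell2 G. \<lambda>x. S f x - T f x)"

definition op_scalar :: "('a, 'm) monoid_scheme \<Rightarrow> complex \<Rightarrow> 'a ell2_op"
  where "op_scalar G c = (\<lambda>f\<in>ell2 G. \<lambda>x. c * f x)"

definition op_adjoint :: "('a, 'm) monoid_scheme \<Rightarrow> 'a ell2_op \<Rightarrow> 'a ell2_op"
  where "op_adjoint G T = (THE S. S \<in> bounded_ops G \<and>
    (\<forall>f\<in>ell2 G. \<forall>g\<in>ell2 G. ell2_inner G (T f) g = ell2_inner G f (S g)))"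


section \<open>The group von Neumann algebra and its projective unitary group\<close>

definition left_regular :: "('a, 'm) monoid_scheme \<Rightarrow> 'a \<Rightarrow> 'a ell2_op"
  where "left_regular G g =
    (\<lambda>f\<in>ell2 G. \<lambda>x. if x \<in> carrier G then f (inv\<^bsub>G\<^esub> g \<otimes>\<^bsub>G\<^esub> x) else 0)"

definition commutant :: "('a, 'm) monoid_scheme \<Rightarrow> 'a ell2_op set \<Rightarrow> 'a ell2_op set"
  where "commutant G A = {T \<in> bounded_ops G. \<forall>S\<in>A. op_compose G T S = op_compose G S T}"

definition group_vN_algebra :: "('a, 'm) monoid_scheme \<Rightarrow> 'a ell2_op set"
  where "group_vN_algebra G = commutant G (commutant G (left_regular G ` carrier G))"

definition vN_trace :: "('a, 'm) monoid_scheme \<Rightarrow> 'a ell2_op \<Rightarrow> complex"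
  where "vN_trace G T = ell2_inner G (T (indicator {\<one>\<^bsub>G\<^esub>})) (indicator {\<one>\<^bsub>G\<^esub>})"

definition vN_norm2 :: "('a, 'm) monoid_scheme \<Rightarrow> 'a ell2_op \<Rightarrow> real"
  where "vN_norm2 G T = sqrt (Re (vN_trace G (op_compose G (op_adjoint G T) T)))"

definition unitary_group :: "('a, 'm) monoid_scheme \<Rightarrow> 'a ell2_op monoid"
  where "unitary_group G =
    \<lparr>carrier = {u \<in> group_vN_algebra G. op_compose G (op_adjoint G u) u = op_scalar G 1 \<and>
                                        op_compose G u (op_adjoint G u) = op_scalar G 1},
     mult = op_compose G, one = op_scalar G 1\<rparr>"

definition circle_subgroup :: "('a, 'm) monoid_scheme \<Rightarrow> 'a ell2_op set"
  where "circle_subgroup G = op_scalar G ` {c. cmod c = 1}"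

definition proj_unitary_group :: "('a, 'm) monoid_scheme \<Rightarrow> 'a ell2_op set monoid"
  where "proj_unitary_group G = unitary_group G Mod circle_subgroup G"

definition proj_left_regular :: "('a, 'm) monoid_scheme \<Rightarrow> 'a \<Rightarrow> 'a ell2_op set"
  where "proj_left_regular G g = circle_subgroup G #>\<^bsub>unitary_group G\<^esub> left_regular G g"

definition proj_length :: "('a, 'm) monoid_scheme \<Rightarrow> 'a ell2_op \<Rightarrow> real"
  where "proj_length G u = (INF c\<in>{c. cmod c = 1}. vN_norm2 G (op_diff G (op_scalar G c) u))"

text \<open>The distance is the length of \<open>u\<^sup>*v\<close>.  As this does not depend on the representatives
  \<open>u\<close>, \<open>v\<close> of two classes \<open>A\<close>, \<open>B\<close>, the set below is a singleton.  The value \<open>0\<close> off the carrier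
  is there because the locale \<open>Metric_space\<close> requires symmetry and nonnegativity everywhere.\<close>

definition proj_dist :: "('a, 'm) monoid_scheme \<Rightarrow> 'a ell2_op set \<Rightarrow> 'a ell2_op set \<Rightarrow> real"
  where "proj_dist G A B =
    (if A \<in> carrier (proj_unitary_group G) \<and> B \<in> carrier (proj_unitary_group G)
     then the_elem {proj_length G (op_compose G (op_adjoint G u) v) |u v. u \<in> A \<and> v \<in> B}
     else 0)"

definition proj_topology :: "('a, 'm) monoid_scheme \<Rightarrow> 'a ell2_op set topology"
  where "proj_topology G = Metric_space.mtopology (carrier (proj_unitary_group G)) (proj_dist G)"


section \<open>Discrete subgroups\<close>

definition discrete_subgroup :: "'g set \<Rightarrow> ('g, 'm) monoid_scheme \<Rightarrow> 'g topology \<Rightarrow> bool"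
  where "discrete_subgroup L P X \<longleftrightarrow>
    subgroup L P \<and> subtopology X L = discrete_topology L"

definition maximal_discrete_subgroup :: "'g set \<Rightarrow> ('g, 'm) monoid_scheme \<Rightarrow> 'g topology \<Rightarrow> bool"
  where "maximal_discrete_subgroup L P X \<longleftrightarrow>
    discrete_subgroup L P X \<and> (\<forall>L'. discrete_subgroup L' P X \<longrightarrow> \<not> L \<subset> L')"

end

theory Submission
  imports Defs
begin

text \<open>
  The idea is that a discrete subgroup \<open>L\<close> of the projective unitary group that contains \<open>G\<close> is
  automatically uniformly discrete, with a constant that does not depend on \<open>L\<close>. Uniform discreteness
  with a fixed constant passes to unions of chains, so Zorn's lemma applies.

  For a unitary \<open>u\<close> in the group von Neumann algebra, let \<open>q = 1 - |\<tau>(u)|\<^sup>2\<close> be its defect. It vanishes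
  exactly for the scalars, and the distance of the class of \<open>u\<close> to the identity is
  \<open>sqrt (2 - 2 |\<tau>(u)|)\<close>; thus discreteness means that the defects of the nontrivial elements are bounded
  away from 0. The uniform bound comes from a Zassenhaus-type argument: if \<open>u\<close> and \<open>k\<close> are free with the
  same defect \<open>q\<close>, then \<open>\<tau>(u k u\<^sup>* k\<^sup>*) = 1 - q\<^sup>2\<close>, so the commutator is nontrivial whenever \<open>u\<close> is,
  and its defect is smaller than \<open>q\<close> by a definite factor once \<open>q\<close> is small
  (\<open>smaller_defect\<close>). Repeating this, a subgroup \<open>L\<close> with an element of small positive
  defect has elements of arbitrarily small positive defect, and is not discrete
  (\<open>discrete_gapped\<close>).

  Freeness is supplied by the absence of mixed identities. The conjugate \<open>k = \<lambda>\<^sub>g u \<lambda>\<^sub>g\<^sup>*\<close> lies in \<open>L\<close>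
  for every \<open>g \<in> G\<close>, and \<open>g\<close> can be chosen to behave like a free variable with respect to any given
  finite set of coefficients: finitely many nontrivial words can be combined into one nontrivial word that
  vanishes wherever one of them does (\<open>mixed_identity_free_avoid_collisions\<close>). To
  use finitely many coefficients only, the trace of the commutator is written as the inner product of
  \<open>u\<^sup>* k\<^sup>* \<delta>\<^sub>1\<close> and \<open>k\<^sup>* u\<^sup>* \<delta>\<^sub>1\<close>. These vectors are approximated in norm, uniformly in \<open>g\<close>, by
  truncating \<open>u\<^sup>* \<delta>\<^sub>1\<close> twice, and the inner product of the approximants is computed exactly
  (\<open>isometry_truncate_twice\<close>, \<open>inner_of_sums_without_collisions\<close>,
  \<open>conjugate_commutator_inner_approx\<close>).
\<close>

section \<open>Mixed identities in one variable\<close>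
context group begin

lemma inv_cancel [simp]:
  assumes "x \<in> carrier G" "y \<in> carrier G"
  shows "inv x \<otimes> (x \<otimes> y) = y" "x \<otimes> (inv x \<otimes> y) = y"
  using assms by (simp_all flip: m_assoc)

lemma int_pow_double: "x \<in> carrier G \<Longrightarrow> x [^] (2 * n :: int) = x [^] n \<otimes> x [^] n"
  by (metis int_pow_mult mult_2)

abbreviation mixed_words :: "(int + 'a) list set"
  where "mixed_words \<equiv> carrier (free_product integer_group G)"

lemma mixed_words_Nil [simp]: "[] \<in> mixed_words"
  by (simp add: free_product_def reduced_words_def)

lemma mixed_words_Cons:
  "s # w \<in> mixed_words \<longleftrightarrow>
     (case s of Inl n \<Rightarrow> n \<noteq> 0 | Inr a \<Rightarrow> a \<in> carrier G \<and> a \<noteq> \<one>) \<and> w \<in> mixed_words \<and>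
     (w = [] \<or> isl s \<noteq> isl (hd w))"
  by (auto simp: free_product_def reduced_words_def successively_Cons integer_group_def split: sum.splits)

lemma mixed_words_append:
  "u @ v \<in> mixed_words \<longleftrightarrow>
     u \<in> mixed_words \<and> v \<in> mixed_words \<and> (u = [] \<or> v = [] \<or> isl (last u) \<noteq> isl (hd v))"
  by (auto simp: free_product_def reduced_words_def successively_append_iff)

lemma eval_word_Nil [simp]: "eval_word G [] g = \<one>"
  by (simp add: eval_word_def)

lemma eval_word_Cons: "eval_word G (s # w) g = eval_syllable G g s \<otimes> eval_word G w g"
  by (simp add: eval_word_def)

lemma eval_syllable_simps [simp]:
  "eval_syllable G g (Inl n) = g [^] n" "eval_syllable G g (Inr a) = a"
  by (simp_all add: eval_syllable_def)

lemma eval_word_closed: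
  assumes "w \<in> mixed_words" "g \<in> carrier G"
  shows "eval_word G w g \<in> carrier G"
  using assms(1)
  by (induction w) (auto simp: mixed_words_Cons eval_word_Cons assms(2) split: sum.splits)

lemma eval_word_append:
  assumes "u \<in> mixed_words" "v \<in> mixed_words" "g \<in> carrier G"
  shows "eval_word G (u @ v) g = eval_word G u g \<otimes> eval_word G v g"
  using assms(1)
  by (induction u)
    (auto simp: mixed_words_Cons eval_word_Cons assms m_assoc eval_word_closed split: sum.splits)

definition inv_word :: "(int + 'a) list \<Rightarrow> (int + 'a) list"
  where "inv_word w = rev (map (map_sum uminus (m_inv G)) w)"

lemma isl_map_sum: "isl (map_sum f h s) = isl s"
  by (cases s) auto

lemma inv_word_closed: "w \<in> mixed_words \<Longrightarrow> inv_word w \<in> mixed_words"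
proof (induction w)
  case (Cons s w)
  then show ?case
    by (cases "w = []")
      (auto simp: inv_word_def mixed_words_append mixed_words_Cons last_rev hd_map isl_map_sum
        split: sum.splits)
qed (simp add: inv_word_def)

lemma inv_word_ends:
  "w \<noteq> [] \<Longrightarrow> isl (hd (inv_word w)) = isl (last w)" "w \<noteq> [] \<Longrightarrow> isl (last (inv_word w)) = isl (hd w)"
  "inv_word w = [] \<longleftrightarrow> w = []"
  by (auto simp: inv_word_def hd_rev last_rev last_map hd_map isl_map_sum)

lemma eval_inv_word:
  assumes "w \<in> mixed_words" "g \<in> carrier G"
  shows "eval_word G (inv_word w) g = inv (eval_word G w g)"
  using assms(1)
proof (induction w)
  case (Cons s w)
  have *: "inv_word (s # w) = inv_word w @ [map_sum uminus (m_inv G) s]"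
    by (simp add: inv_word_def)
  have "w \<in> mixed_words" "[map_sum uminus (m_inv G) s] \<in> mixed_words"
    using Cons.prems by (auto simp: mixed_words_Cons split: sum.splits)
  then show ?case
    using Cons unfolding *
    by (auto simp: mixed_words_Cons eval_word_append inv_word_closed eval_word_Cons assms(2)
        inv_mult_group eval_word_closed int_pow_neg split: sum.splits)
qed (simp add: inv_word_def)

text \<open>Conjugation does not change where a word vanishes, and conjugating by a suitable power of the
  variable turns a nonempty word into one that both begins and ends in the variable. Such words can
  be joined through nontrivial coefficients without cancellation.\<close>

lemma conjugate_begins_ends_in_variable:
  assumes "w \<in> mixed_words" "w \<noteq> []"
  obtains w' where "w' \<in> mixed_words" "w' \<noteq> []" "isl (hd w')" "isl (last w')"
    "\<And>g. g \<in> carrier G \<Longrightarrow> eval_word G w g = \<one> \<Longrightarrow> eval_word G w' g = \<one>"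
proof -
  consider (ll) "isl (hd w)" "isl (last w)" | (lr) "isl (hd w)" "\<not> isl (last w)"
    | (rl) "\<not> isl (hd w)" "isl (last w)" | (rr) "\<not> isl (hd w)" "\<not> isl (last w)" by blast
  then show ?thesis
  proof cases
    case ll
    then show ?thesis using assms that by blast
  next
    case lr
    then obtain n v where w: "w = Inl n # v"
      using assms by (cases w) (auto simp: isl_def)
    have v: "n \<noteq> 0" "v \<noteq> []" "v \<in> mixed_words" "\<not> isl (hd v)" "\<not> isl (last v)"
      using lr assms unfolding w by (auto simp: mixed_words_Cons split: if_splits)
    \<comment> \<open>conjugation by \<open>t\<^sup>n\<close>: as \<open>n \<noteq> 0\<close>, the first exponent \<open>2 n\<close> does not vanish\<close>
    let ?w = "Inl (n + n) # v @ [Inl (- n)]"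
    show ?thesis
    proof (rule that[of ?w])
      show "?w \<in> mixed_words"
        using v by (auto simp: mixed_words_Cons mixed_words_append)
      fix g assume g: "g \<in> carrier G" "eval_word G w g = \<one>"
      have "eval_word G ?w g = g [^] n \<otimes> eval_word G w g \<otimes> inv (g [^] n)"
        using v g(1) unfolding w
        by (simp add: eval_word_Cons eval_word_append mixed_words_Cons int_pow_double int_pow_neg
            m_assoc eval_word_closed)
      then show "eval_word G ?w g = \<one>"
        using g by simp
    qed auto
  next
    case rl
    then obtain n v where w: "w = v @ [Inl n]"
      using assms by (cases w rule: rev_cases) (auto simp: isl_def)
    have "v \<noteq> []"
      using rl unfolding w by auto
    then have v: "n \<noteq> 0" "v \<noteq> []" "v \<in> mixed_words" "\<not> isl (hd v)" "\<not> isl (last v)"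
      using rl assms unfolding w by (auto simp: mixed_words_Cons mixed_words_append)
    let ?w = "Inl (- n) # v @ [Inl (n + n)]"
    show ?thesis
    proof (rule that[of ?w])
      show "?w \<in> mixed_words"
        using v by (auto simp: mixed_words_Cons mixed_words_append)
      fix g assume g: "g \<in> carrier G" "eval_word G w g = \<one>"
      have "eval_word G ?w g = inv (g [^] n) \<otimes> eval_word G w g \<otimes> g [^] n"
        using v g(1) unfolding w
        by (simp add: eval_word_Cons eval_word_append mixed_words_Cons int_pow_double int_pow_neg
            m_assoc eval_word_closed)
      then show "eval_word G ?w g = \<one>"
        using g by simp
    qed auto
  next
    case rr
    let ?w = "Inl 1 # w @ [Inl (- 1)]"
    show ?thesis
    proof (rule that[of ?w])
      show "?w \<in> mixed_words"
        using rr assms by (auto simp: mixed_words_Cons mixed_words_append)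
      fix g assume g: "g \<in> carrier G" "eval_word G w g = \<one>"
      have "eval_word G ?w g = g \<otimes> eval_word G w g \<otimes> inv g"
        using assms g(1)
        by (simp add: eval_word_Cons eval_word_append mixed_words_Cons int_pow_neg m_assoc
            eval_word_closed int_pow_1)
      then show "eval_word G ?w g = \<one>"
        using g by simp
    qed auto
  qed
qed

lemma mixed_identity_free_nontrivial:
  assumes "mixed_identity_free G"
  obtains c where "c \<in> carrier G" "c \<noteq> \<one>"
proof -
  have "\<not> mixed_identity G [Inl 1]"
    using assms by (auto simp: mixed_identity_free_def free_product_def)
  then show ?thesis
    using that by (auto simp: mixed_identity_def mixed_words_Cons eval_word_Cons int_pow_1)
qed

text \<open>With \<open>c \<noteq> 1\<close>, the commutator of \<open>u\<close> and \<open>c v c\<inverse>\<close> evaluates to the identity as soon as one of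
  \<open>u\<close> and \<open>v\<close> does; when \<open>u\<close> and \<open>v\<close> begin and end in the variable, the concatenation that spells it
  out is already reduced, hence nontrivial.\<close>

lemma common_vanishing_word2:
  assumes "mixed_identity_free G"
    and "u \<in> mixed_words" "u \<noteq> []" "v \<in> mixed_words" "v \<noteq> []"
  obtains w where "w \<in> mixed_words" "w \<noteq> []"
    "\<And>g. g \<in> carrier G \<Longrightarrow> eval_word G u g = \<one> \<or> eval_word G v g = \<one> \<Longrightarrow> eval_word G w g = \<one>"
proof -
  obtain c where c: "c \<in> carrier G" "c \<noteq> \<one>"
    using mixed_identity_free_nontrivial[OF assms(1)] .
  obtain u' where u: "u' \<in> mixed_words" "u' \<noteq> []" "isl (hd u')" "isl (last u')"
    "\<And>g. g \<in> carrier G \<Longrightarrow> eval_word G u g = \<one> \<Longrightarrow> eval_word G u' g = \<one>"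
    using conjugate_begins_ends_in_variable[OF assms(2,3)] by metis
  obtain v' where v: "v' \<in> mixed_words" "v' \<noteq> []" "isl (hd v')" "isl (last v')"
    "\<And>g. g \<in> carrier G \<Longrightarrow> eval_word G v g = \<one> \<Longrightarrow> eval_word G v' g = \<one>"
    using conjugate_begins_ends_in_variable[OF assms(4,5)] by metis
  let ?c = "[Inr c] :: (int + 'a) list" and ?d = "[Inr (inv c)] :: (int + 'a) list"
  let ?w = "u' @ ?c @ v' @ ?d @ inv_word u' @ ?c @ inv_word v' @ ?d"
  have cd: "?c \<in> mixed_words" "?d \<in> mixed_words"
    using c by (auto simp: mixed_words_Cons)
  have w: "v' @ ?d @ inv_word u' @ ?c @ inv_word v' @ ?d \<in> mixed_words" "?w \<in> mixed_words"
    "?d @ inv_word u' @ ?c @ inv_word v' @ ?d \<in> mixed_words"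
    "inv_word u' @ ?c @ inv_word v' @ ?d \<in> mixed_words"
    "?c @ v' @ ?d @ inv_word u' @ ?c @ inv_word v' @ ?d \<in> mixed_words"
    "?c @ inv_word v' @ ?d \<in> mixed_words" "inv_word v' @ ?d \<in> mixed_words"
    using u v c by (auto simp: mixed_words_append mixed_words_Cons inv_word_closed inv_word_ends)
  show ?thesis
  proof (rule that[of ?w])
    fix g assume g: "g \<in> carrier G" "eval_word G u g = \<one> \<or> eval_word G v g = \<one>"
    define a b where "a = eval_word G u' g" and "b = eval_word G v' g"
    have ab: "a \<in> carrier G" "b \<in> carrier G" "a = \<one> \<or> b = \<one>"
      using g u v by (auto simp: a_def b_def eval_word_closed)
    have "eval_word G ?c g = c" "eval_word G ?d g = inv c"
      using c by (auto simp: eval_word_Cons)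
    then have "eval_word G ?w g = a \<otimes> (c \<otimes> (b \<otimes> (inv c \<otimes> (inv a \<otimes> (c \<otimes> (inv b \<otimes> inv c))))))"
      using u v g(1) w cd
      by (simp only: eval_word_append inv_word_closed eval_inv_word a_def b_def)
    also have "\<dots> = \<one>"
    proof (cases "a = \<one>")
      case True
      then show ?thesis using ab c by simp
    next
      case False
      then have "b = \<one>" using ab by simp
      then show ?thesis using ab c by simp
    qed
    finally show "eval_word G ?w g = \<one>" .
  qed (use w u in auto)
qed

text \<open>Iterating the commutator trick gives one nontrivial word that vanishes wherever some word of the
  finite set does; a group element at which this word does not vanish avoids the whole set.\<close>

lemma avoid_finitely_many_mixed_words:
  assumes "mixed_identity_free G" "finite W" "W \<subseteq> mixed_words" "[] \<notin> W"
  obtains g where "g \<in> carrier G" "\<And>w. w \<in> W \<Longrightarrow> eval_word G w g \<noteq> \<one>"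
proof -
  have "\<exists>v\<in>mixed_words. v \<noteq> [] \<and>
      (\<forall>g\<in>carrier G. (\<exists>w\<in>W. eval_word G w g = \<one>) \<longrightarrow> eval_word G v g = \<one>)"
    using assms(2-)
  proof (induction W)
    case empty
    have "[Inl 1] \<in> mixed_words"
      by (simp add: mixed_words_Cons)
    then show ?case by blast
  next
    case (insert w W)
    then obtain v where v: "v \<in> mixed_words" "v \<noteq> []"
      "\<forall>g\<in>carrier G. (\<exists>w\<in>W. eval_word G w g = \<one>) \<longrightarrow> eval_word G v g = \<one>"
      by auto
    have "w \<in> mixed_words" "w \<noteq> []"
      using insert.prems by auto
    then obtain v' where "v' \<in> mixed_words" "v' \<noteq> []"
      "\<And>g. g \<in> carrier G \<Longrightarrow> eval_word G w g = \<one> \<or> eval_word G v g = \<one> \<Longrightarrow> eval_word G v' g = \<one>"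
      using common_vanishing_word2[OF assms(1) _ _ v(1,2)] by metis
    then show ?case
      using v(3) by (intro bexI[of _ v']) auto
  qed
  then obtain v where v: "v \<in> mixed_words" "v \<noteq> []"
    "\<forall>g\<in>carrier G. (\<exists>w\<in>W. eval_word G w g = \<one>) \<longrightarrow> eval_word G v g = \<one>"
    by blast
  have "\<not> mixed_identity G v"
    using assms(1) v(2) by (auto simp: mixed_identity_free_def free_product_def)
  then show ?thesis
    using v that by (auto simp: mixed_identity_def)
qed

text \<open>The identity is not a syllable of a reduced word, so the trivial coefficient is the empty word.\<close>

definition coeff_word :: "'a \<Rightarrow> (int + 'a) list"
  where "coeff_word a = (if a = \<one> then [] else [Inr a])"

text \<open>The equation says that \<open>t b t\<inverse> d\<inverse> t c\<inverse> t\<inverse> a\<close> vanishes at \<open>g\<close>. This word is reduced if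
  \<open>b\<close>, \<open>c\<close> and \<open>d\<close> are nontrivial. Otherwise it collapses to a shorter word, which is nontrivial except in
  the two excluded cases: there the equation holds identically in \<open>g\<close>.\<close>

lemma collision_word:
  assumes "a \<in> carrier G" "b \<in> carrier G" "c \<in> carrier G" "d \<in> carrier G"
    and "\<not> (a = \<one> \<and> d = \<one> \<and> b = c)" "\<not> (b = \<one> \<and> c = \<one> \<and> a = d)"
  obtains w where "w \<in> mixed_words" "w \<noteq> []"
    "\<And>g. g \<in> carrier G \<Longrightarrow> a \<otimes> g \<otimes> b \<otimes> inv g = g \<otimes> c \<otimes> inv g \<otimes> d \<Longrightarrow> eval_word G w g = \<one>"
proof -
  have rearrange: "g \<otimes> (b \<otimes> (inv g \<otimes> (inv d \<otimes> (g \<otimes> (inv c \<otimes> (inv g \<otimes> a)))))) = \<one>"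
    if g: "g \<in> carrier G" and eq: "a \<otimes> g \<otimes> b \<otimes> inv g = g \<otimes> c \<otimes> inv g \<otimes> d" for g
  proof -
    have "g \<otimes> (b \<otimes> (inv g \<otimes> (inv d \<otimes> (g \<otimes> (inv c \<otimes> (inv g \<otimes> a))))))
        = inv a \<otimes> (a \<otimes> g \<otimes> b \<otimes> inv g) \<otimes> (inv d \<otimes> (g \<otimes> (inv c \<otimes> (inv g \<otimes> a))))"
      using assms g by (simp add: m_assoc)
    also have "\<dots> = \<one>"
      unfolding eq using assms g by (simp add: m_assoc)
    finally show ?thesis .
  qed
  consider (generic) "b \<noteq> \<one>" "c \<noteq> \<one>" "d \<noteq> \<one>" | (d) "d = \<one>" "b \<noteq> c" | (da) "d = \<one>" "b = c" "a \<noteq> \<one>"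
    | (b) "d \<noteq> \<one>" "b = \<one>" "c \<noteq> \<one>" | (bc) "d \<noteq> \<one>" "b = \<one>" "c = \<one>" "a \<noteq> d"
    | (c) "d \<noteq> \<one>" "b \<noteq> \<one>" "c = \<one>"
    using assms(5,6) by blast
  then show ?thesis
  proof cases
    case generic
    show ?thesis
    proof (rule that[of "[Inl 1, Inr b, Inl (-1), Inr (inv d), Inl 1, Inr (inv c), Inl (-1)] @ coeff_word a"])
      fix g assume g: "g \<in> carrier G" "a \<otimes> g \<otimes> b \<otimes> inv g = g \<otimes> c \<otimes> inv g \<otimes> d"
      show "eval_word G ([Inl 1, Inr b, Inl (-1), Inr (inv d), Inl 1, Inr (inv c), Inl (-1)] @ coeff_word a) g = \<one>"
        using rearrange[OF g] generic g(1) assms(1-4)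
        by (auto simp: eval_word_Cons int_pow_neg coeff_word_def m_assoc)
    qed (use generic assms(1-4) in \<open>auto simp: mixed_words_append mixed_words_Cons coeff_word_def\<close>)
  next
    case d
    have "b \<otimes> inv c \<noteq> \<one>"
      using assms d(2) by (metis inv_equality inv_inv inv_closed)
    then show ?thesis
    proof (intro that[of "[Inl 1, Inr (b \<otimes> inv c), Inl (-1)] @ coeff_word a"])
      fix g assume g: "g \<in> carrier G" "a \<otimes> g \<otimes> b \<otimes> inv g = g \<otimes> c \<otimes> inv g \<otimes> d"
      have "g \<otimes> (b \<otimes> (inv c \<otimes> (inv g \<otimes> a))) = \<one>"
        using rearrange[OF g] d g(1) assms by simp
      then show "eval_word G ([Inl 1, Inr (b \<otimes> inv c), Inl (-1)] @ coeff_word a) g = \<one>"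
        using g(1) assms
        by (auto simp: eval_word_Cons int_pow_neg coeff_word_def m_assoc)
    qed (use d assms in \<open>auto simp: mixed_words_append mixed_words_Cons coeff_word_def\<close>)
  next
    case da
    show ?thesis
    proof (rule that[of "[Inr a]"])
      fix g assume g: "g \<in> carrier G" "a \<otimes> g \<otimes> b \<otimes> inv g = g \<otimes> c \<otimes> inv g \<otimes> d"
      show "eval_word G ([Inr a]) g = \<one>"
        using rearrange[OF g] da g(1) assms(1-4)
        by (auto simp: eval_word_Cons int_pow_neg coeff_word_def m_assoc)
    qed (use da assms(1-4) in \<open>auto simp: mixed_words_append mixed_words_Cons coeff_word_def\<close>)
  next
    case b
    show ?thesis
    proof (intro that[of "[Inr (inv d), Inl 1, Inr (inv c), Inl (-1)] @ coeff_word a"])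
      fix g assume g: "g \<in> carrier G" "a \<otimes> g \<otimes> b \<otimes> inv g = g \<otimes> c \<otimes> inv g \<otimes> d"
      show "eval_word G ([Inr (inv d), Inl 1, Inr (inv c), Inl (-1)] @ coeff_word a) g = \<one>"
        using rearrange[OF g] b g(1) assms(1-4)
        by (auto simp: eval_word_Cons int_pow_neg coeff_word_def m_assoc)
    qed (use b assms(1-4) in \<open>auto simp: mixed_words_append mixed_words_Cons coeff_word_def\<close>)
  next
    case bc
    then have "inv d \<otimes> a \<noteq> \<one>"
      using assms by (metis inv_equality inv_inv inv_closed)
    then show ?thesis
    proof (intro that[of "[Inr (inv d \<otimes> a)]"])
      fix g assume g: "g \<in> carrier G" "a \<otimes> g \<otimes> b \<otimes> inv g = g \<otimes> c \<otimes> inv g \<otimes> d"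
      show "eval_word G ([Inr (inv d \<otimes> a)]) g = \<one>"
        using rearrange[OF g] bc g(1) assms(1-4)
        by (auto simp: eval_word_Cons int_pow_neg coeff_word_def m_assoc)
    qed (use bc assms(1-4) in \<open>auto simp: mixed_words_append mixed_words_Cons coeff_word_def\<close>)
  next
    case c
    show ?thesis
    proof (rule that[of "[Inl 1, Inr b, Inl (-1)] @ coeff_word (inv d \<otimes> a)"])
      fix g assume g: "g \<in> carrier G" "a \<otimes> g \<otimes> b \<otimes> inv g = g \<otimes> c \<otimes> inv g \<otimes> d"
      show "eval_word G ([Inl 1, Inr b, Inl (-1)] @ coeff_word (inv d \<otimes> a)) g = \<one>"
        using rearrange[OF g] c g(1) assms(1-4)
        by (auto simp: eval_word_Cons int_pow_neg coeff_word_def m_assoc)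
    qed (use c assms(1-4) in \<open>auto simp: mixed_words_append mixed_words_Cons coeff_word_def\<close>)
  qed
qed

text \<open>For the products that occur in the commutator estimate, a suitable \<open>g\<close> behaves like a free
  variable: the only coincidences among them are those that hold identically in \<open>g\<close>.\<close>

lemma mixed_identity_free_avoid_collisions:
  assumes "mixed_identity_free G" "finite F" "F \<subseteq> carrier G"
  obtains g where "g \<in> carrier G"
    "\<And>a b c d. a \<in> F \<Longrightarrow> b \<in> F \<Longrightarrow> c \<in> F \<Longrightarrow> d \<in> F \<Longrightarrow>
       a \<otimes> g \<otimes> b \<otimes> inv g = g \<otimes> c \<otimes> inv g \<otimes> d \<longleftrightarrow>
       a = \<one> \<and> d = \<one> \<and> b = c \<or> b = \<one> \<and> c = \<one> \<and> a = d"
proof -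
  define Q where "Q = {(a, b, c, d) \<in> F \<times> F \<times> F \<times> F.
      \<not> (a = \<one> \<and> d = \<one> \<and> b = c) \<and> \<not> (b = \<one> \<and> c = \<one> \<and> a = d)}"
  define good where "good = (\<lambda>(a, b, c, d) w. w \<in> mixed_words \<and> w \<noteq> [] \<and> (\<forall>g\<in>carrier G.
      a \<otimes> g \<otimes> b \<otimes> inv g = g \<otimes> c \<otimes> inv g \<otimes> d \<longrightarrow> eval_word G w g = \<one>))"
  have "\<exists>w. good q w" if "q \<in> Q" for q
  proof -
    obtain a b c d where q: "q = (a, b, c, d)" by (cases q)
    have "a \<in> carrier G" "b \<in> carrier G" "c \<in> carrier G" "d \<in> carrier G"
      "\<not> (a = \<one> \<and> d = \<one> \<and> b = c)" "\<not> (b = \<one> \<and> c = \<one> \<and> a = d)"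
      using that assms(3) unfolding q Q_def by auto
    then obtain w where w: "w \<in> mixed_words" "w \<noteq> []"
      "\<And>g. g \<in> carrier G \<Longrightarrow> a \<otimes> g \<otimes> b \<otimes> inv g = g \<otimes> c \<otimes> inv g \<otimes> d \<Longrightarrow> eval_word G w g = \<one>"
      by (rule collision_word) blast
    then have "good q w"
      unfolding q good_def by simp
    then show ?thesis ..
  qed
  then obtain f where f: "\<And>q. q \<in> Q \<Longrightarrow> good q (f q)" by metis
  have "finite Q"
    unfolding Q_def using assms(2) by (auto intro: finite_subset[of _ "F \<times> F \<times> F \<times> F"])
  have "f q \<in> mixed_words" "f q \<noteq> []" if "q \<in> Q" for q
    using f[OF that] by (auto simp: good_def split: prod.splits)
  then have "f ` Q \<subseteq> mixed_words" "[] \<notin> f ` Q" "finite (f ` Q)"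
    using \<open>finite Q\<close> by force+
  from avoid_finitely_many_mixed_words[OF assms(1) this(3,1,2)]
  obtain g where g: "g \<in> carrier G" "\<And>w. w \<in> f ` Q \<Longrightarrow> eval_word G w g \<noteq> \<one>"
    by blast
  show ?thesis
  proof (rule that[OF g(1)])
    fix a b c d assume F: "a \<in> F" "b \<in> F" "c \<in> F" "d \<in> F"
    show "a \<otimes> g \<otimes> b \<otimes> inv g = g \<otimes> c \<otimes> inv g \<otimes> d \<longleftrightarrow>
        a = \<one> \<and> d = \<one> \<and> b = c \<or> b = \<one> \<and> c = \<one> \<and> a = d"
    proof
      assume eq: "a \<otimes> g \<otimes> b \<otimes> inv g = g \<otimes> c \<otimes> inv g \<otimes> d"
      show "a = \<one> \<and> d = \<one> \<and> b = c \<or> b = \<one> \<and> c = \<one> \<and> a = d"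
      proof (rule ccontr)
        assume "\<not> ?thesis"
        then have q: "(a, b, c, d) \<in> Q" using F by (auto simp: Q_def)
        have "eval_word G (f (a, b, c, d)) g = \<one>"
          using f[OF q] eq g(1) by (auto simp: good_def)
        then show False using g(2) q by blast
      qed
    next
      assume "a = \<one> \<and> d = \<one> \<and> b = c \<or> b = \<one> \<and> c = \<one> \<and> a = d"
      then show "a \<otimes> g \<otimes> b \<otimes> inv g = g \<otimes> c \<otimes> inv g \<otimes> d"
        using F g(1) assms(3) by (auto simp: m_assoc subset_iff)
    qed
  qed
qed

end

section \<open>The Hilbert space of square-summable functions\<close>
abbreviation delta :: "'a \<Rightarrow> 'a \<Rightarrow> complex"
  where "delta a \<equiv> indicator {a}"

lemma ell2D: "f \<in> ell2 G \<Longrightarrow> x \<notin> carrier G \<Longrightarrow> f x = 0"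
  "f \<in> ell2 G \<Longrightarrow> (\<lambda>x. (cmod (f x))\<^sup>2) summable_on carrier G"
  by (auto simp: ell2_def)

lemma ell2_finite_bound:
  assumes "\<And>x. x \<notin> carrier G \<Longrightarrow> f x = 0"
    and "\<And>F. finite F \<Longrightarrow> F \<subseteq> carrier G \<Longrightarrow> (\<Sum>x\<in>F. (cmod (f x))\<^sup>2) \<le> B\<^sup>2" "0 \<le> B"
  shows "f \<in> ell2 G" "ell2_norm G f \<le> B"
proof -
  have s: "(\<lambda>x. (cmod (f x))\<^sup>2) summable_on carrier G"
    by (rule nonneg_bdd_above_summable_on) (auto intro!: bdd_aboveI2[of _ _ "B\<^sup>2"] assms(2))
  then show "f \<in> ell2 G"
    using assms(1) by (simp add: ell2_def)
  have "(\<Sum>\<^sub>\<infinity>x\<in>carrier G. (cmod (f x))\<^sup>2) \<le> B\<^sup>2"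
    by (rule infsum_le_finite_sums[OF s]) (rule assms(2))
  then show "ell2_norm G f \<le> B"
    using assms(3) by (simp add: ell2_norm_def real_le_lsqrt)
qed

lemma ell2_norm_nonneg [simp]: "0 \<le> ell2_norm G f"
  by (simp add: ell2_norm_def infsum_nonneg)

lemma ell2_norm_squared: "(ell2_norm G f)\<^sup>2 = (\<Sum>\<^sub>\<infinity>x\<in>carrier G. (cmod (f x))\<^sup>2)"
  by (simp add: ell2_norm_def infsum_nonneg)

lemma sum_le_ell2_norm_squared:
  assumes "f \<in> ell2 G" "finite F" "F \<subseteq> carrier G"
  shows "(\<Sum>x\<in>F. (cmod (f x))\<^sup>2) \<le> (ell2_norm G f)\<^sup>2"
  unfolding ell2_norm_squared using assms by (intro finite_sum_le_infsum) (auto simp: ell2D)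

lemma L2_set_le_ell2_norm:
  assumes "f \<in> ell2 G" "finite F" "F \<subseteq> carrier G"
  shows "L2_set (\<lambda>x. cmod (f x)) F \<le> ell2_norm G f"
  unfolding L2_set_def using sum_le_ell2_norm_squared[OF assms] by (simp add: real_le_lsqrt sum_nonneg)

lemma norm_apply_le_ell2_norm:
  assumes "f \<in> ell2 G"
  shows "cmod (f x) \<le> ell2_norm G f"
proof (cases "x \<in> carrier G")
  case True
  then show ?thesis
    using L2_set_le_ell2_norm[OF assms, of "{x}"] by simp
qed (simp add: ell2D[OF assms])

lemma ell2_add:
  assumes "f \<in> ell2 G" "g \<in> ell2 G"
  shows "(\<lambda>x. f x + g x) \<in> ell2 G" (is ?A)
    and ell2_norm_triangle: "ell2_norm G (\<lambda>x. f x + g x) \<le> ell2_norm G f + ell2_norm G g" (is ?B)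
proof -
  have "(\<Sum>x\<in>F. (cmod (f x + g x))\<^sup>2) \<le> (ell2_norm G f + ell2_norm G g)\<^sup>2"
    if F: "finite F" "F \<subseteq> carrier G" for F
  proof -
    have "sqrt (\<Sum>x\<in>F. (cmod (f x + g x))\<^sup>2) \<le> L2_set (\<lambda>x. cmod (f x) + cmod (g x)) F"
      unfolding L2_set_def by (intro real_sqrt_le_mono sum_mono power_mono norm_triangle_ineq) auto
    also have "\<dots> \<le> L2_set (\<lambda>x. cmod (f x)) F + L2_set (\<lambda>x. cmod (g x)) F"
      by (rule L2_set_triangle_ineq)
    also have "\<dots> \<le> ell2_norm G f + ell2_norm G g"
      by (intro add_mono L2_set_le_ell2_norm assms F)
    finally show ?thesis
      by (simp add: sqrt_le_D)
  qed
  note bound = ell2_finite_bound[OF _ this]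
  show ?A ?B
    using assms by (auto intro!: bound simp: ell2D)
qed

lemma ell2_scale [simp]: "f \<in> ell2 G \<Longrightarrow> (\<lambda>x. c * f x) \<in> ell2 G"
  by (auto simp: ell2_def norm_mult power_mult_distrib intro: summable_on_cmult_right)

lemma ell2_norm_scale [simp]: "ell2_norm G (\<lambda>x. c * f x) = cmod c * ell2_norm G f"
  by (simp add: ell2_norm_def norm_mult power_mult_distrib infsum_cmult_right' real_sqrt_mult)

lemma ell2_zero [simp]: "(\<lambda>x. 0) \<in> ell2 G"
  by (simp add: ell2_def)

lemma ell2_norm_zero [simp]: "ell2_norm G (\<lambda>x. 0) = 0"
  by (simp add: ell2_norm_def)

lemma ell2_diff:
  assumes "f \<in> ell2 G" "g \<in> ell2 G"
  shows "(\<lambda>x. f x - g x) \<in> ell2 G"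
    and "ell2_norm G (\<lambda>x. f x - g x) \<le> ell2_norm G f + ell2_norm G g"
  using ell2_add[OF assms(1) ell2_scale[OF assms(2)], of "-1"]
    ell2_norm_triangle[OF assms(1) ell2_scale[OF assms(2)], of "-1"] ell2_norm_scale[of G "-1" g]
  by simp_all

lemma ell2_norm_triangle_diff:
  assumes "f \<in> ell2 G" "g \<in> ell2 G" "h \<in> ell2 G"
  shows "ell2_norm G (\<lambda>x. f x - h x) \<le> ell2_norm G (\<lambda>x. f x - g x) + ell2_norm G (\<lambda>x. g x - h x)"
  using ell2_norm_triangle[OF ell2_diff(1)[OF assms(1,2)] ell2_diff(1)[OF assms(2,3)]] by simp

lemma ell2_sum:
  assumes "\<And>b. b \<in> F \<Longrightarrow> v b \<in> ell2 G"
  shows "(\<lambda>x. \<Sum>b\<in>F. v b x) \<in> ell2 G"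
    and "ell2_norm G (\<lambda>x. \<Sum>b\<in>F. v b x) \<le> (\<Sum>b\<in>F. ell2_norm G (v b))"
proof -
  have "(\<lambda>x. \<Sum>b\<in>F. v b x) \<in> ell2 G \<and>
    ell2_norm G (\<lambda>x. \<Sum>b\<in>F. v b x) \<le> (\<Sum>b\<in>F. ell2_norm G (v b))"
    using assms
  proof (induction F rule: infinite_finite_induct)
    case (insert b F)
    then show ?case
      using ell2_add[of "v b" G "\<lambda>x. \<Sum>b\<in>F. v b x"] ell2_norm_triangle[of "v b" G "\<lambda>x. \<Sum>b\<in>F. v b x"]
      by (auto intro: order_trans)
  qed auto
  then show "(\<lambda>x. \<Sum>b\<in>F. v b x) \<in> ell2 G"
    and "ell2_norm G (\<lambda>x. \<Sum>b\<in>F. v b x) \<le> (\<Sum>b\<in>F. ell2_norm G (v b))" by auto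
qed

lemma ell2_norm_eq_0: "f \<in> ell2 G \<Longrightarrow> ell2_norm G f = 0 \<Longrightarrow> f = (\<lambda>x. 0)"
  using norm_apply_le_ell2_norm by fastforce

lemma delta_ell2 [simp]:
  assumes "a \<in> carrier G"
  shows "delta a \<in> ell2 G" and ell2_norm_delta: "ell2_norm G (delta a) = 1"
proof -
  have "((\<lambda>x. (cmod (delta a x))\<^sup>2) has_sum 1) (carrier G)"
    by (rule has_sum_finite_neutralI[of "{a}"]) (use assms in auto)
  then show "delta a \<in> ell2 G" "ell2_norm G (delta a) = 1"
    using assms by (auto simp: ell2_def ell2_norm_def infsumI indicator_def intro: has_sum_imp_summable)
qed

lemma ell2_inner_abs_summable:
  assumes "f \<in> ell2 G" "g \<in> ell2 G"
  shows "(\<lambda>x. cmod (f x * cnj (g x))) summable_on carrier G"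
proof (rule Infinite_Sum.abs_summable_on_comparison_test')
  show "(\<lambda>x. (cmod (f x))\<^sup>2 + (cmod (g x))\<^sup>2) summable_on carrier G"
    using assms by (intro summable_on_add) (auto simp: ell2D)
  show "cmod (f x * cnj (g x)) \<le> (cmod (f x))\<^sup>2 + (cmod (g x))\<^sup>2" for x
  proof -
    have "0 \<le> (cmod (f x) - cmod (g x))\<^sup>2" "0 \<le> cmod (f x) * cmod (g x)" by simp_all
    then show ?thesis
      unfolding norm_mult complex_mod_cnj power2_diff by linarith
  qed
qed

lemma ell2_inner_summable:
  "f \<in> ell2 G \<Longrightarrow> g \<in> ell2 G \<Longrightarrow> (\<lambda>x. f x * cnj (g x)) summable_on carrier G"
  by (rule abs_summable_summable[OF ell2_inner_abs_summable])

lemma ell2_inner_add_left: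
  assumes "f \<in> ell2 G" "f' \<in> ell2 G" "g \<in> ell2 G"
  shows "ell2_inner G (\<lambda>x. f x + f' x) g = ell2_inner G f g + ell2_inner G f' g"
  unfolding ell2_inner_def distrib_right by (intro infsum_add ell2_inner_summable assms)

lemma ell2_inner_scale_left [simp]: "ell2_inner G (\<lambda>x. c * f x) g = c * ell2_inner G f g"
  unfolding ell2_inner_def by (simp add: infsum_cmult_right' mult.assoc)

lemma ell2_inner_commute: "ell2_inner G f g = cnj (ell2_inner G g f)"
  unfolding ell2_inner_def infsum_cnj[symmetric] by (simp add: mult.commute)

lemma ell2_inner_scale_right [simp]: "ell2_inner G f (\<lambda>x. c * g x) = cnj c * ell2_inner G f g"
  using ell2_inner_scale_left by (metis ell2_inner_commute complex_cnj_mult)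

lemma ell2_inner_diff_left:
  assumes "f \<in> ell2 G" "f' \<in> ell2 G" "g \<in> ell2 G"
  shows "ell2_inner G (\<lambda>x. f x - f' x) g = ell2_inner G f g - ell2_inner G f' g"
  using ell2_inner_add_left[OF assms(1) ell2_scale[OF assms(2), of "-1"] assms(3)]
    ell2_inner_scale_left[of G "-1" f' g] by simp

lemma ell2_inner_diff_right:
  assumes "f \<in> ell2 G" "g \<in> ell2 G" "g' \<in> ell2 G"
  shows "ell2_inner G f (\<lambda>x. g x - g' x) = ell2_inner G f g - ell2_inner G f g'"
  using ell2_inner_diff_left[OF assms(2,3,1)] by (metis ell2_inner_commute complex_cnj_diff)

lemma ell2_inner_zero_left [simp]: "ell2_inner G (\<lambda>x. 0) g = 0"
  by (simp add: ell2_inner_def)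

lemma ell2_inner_sum_left:
  assumes "\<And>b. b \<in> F \<Longrightarrow> v b \<in> ell2 G" "g \<in> ell2 G"
  shows "ell2_inner G (\<lambda>x. \<Sum>b\<in>F. v b x) g = (\<Sum>b\<in>F. ell2_inner G (v b) g)"
  using assms(1)
  by (induction F rule: infinite_finite_induct) (auto simp: ell2_inner_add_left ell2_sum(1) assms(2))

lemma ell2_inner_sum_right:
  assumes "\<And>b. b \<in> F \<Longrightarrow> v b \<in> ell2 G" "g \<in> ell2 G"
  shows "ell2_inner G g (\<lambda>x. \<Sum>b\<in>F. v b x) = (\<Sum>b\<in>F. ell2_inner G g (v b))"
proof -
  have "ell2_inner G g (\<lambda>x. \<Sum>b\<in>F. v b x) = cnj (\<Sum>b\<in>F. ell2_inner G (v b) g)"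
    by (subst ell2_inner_commute) (simp add: ell2_inner_sum_left assms)
  then show ?thesis
    by (simp flip: ell2_inner_commute[of G g])
qed

lemma ell2_inner_self:
  assumes "f \<in> ell2 G"
  shows "ell2_inner G f f = of_real ((ell2_norm G f)\<^sup>2)"
proof -
  have "((\<lambda>x. (cmod (f x))\<^sup>2) has_sum (ell2_norm G f)\<^sup>2) (carrier G)"
    unfolding ell2_norm_squared by (rule has_sum_infsum[OF ell2D(2)[OF assms]])
  then have "((\<lambda>x. complex_of_real ((cmod (f x))\<^sup>2)) has_sum of_real ((ell2_norm G f)\<^sup>2)) (carrier G)"
    by (simp only: has_sum_of_real_iff)
  then show ?thesis
    unfolding ell2_inner_def complex_norm_square by (rule infsumI)
qed

lemma ell2_inner_delta [simp]:
  assumes "a \<in> carrier G"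
  shows "ell2_inner G f (delta a) = f a"
proof -
  have "((\<lambda>x. f x * cnj (delta a x)) has_sum f a) (carrier G)"
    by (rule has_sum_finite_neutralI[of "{a}"]) (use assms in auto)
  then show ?thesis
    by (simp add: ell2_inner_def infsumI)
qed

lemma ell2_inner_delta_left [simp]: "a \<in> carrier G \<Longrightarrow> ell2_inner G (delta a) f = cnj (f a)"
  by (subst ell2_inner_commute) simp

lemma ell2_Cauchy_Schwarz:
  assumes "f \<in> ell2 G" "g \<in> ell2 G"
  shows "cmod (ell2_inner G f g) \<le> ell2_norm G f * ell2_norm G g"
proof -
  have "cmod (ell2_inner G f g) \<le> (\<Sum>\<^sub>\<infinity>x\<in>carrier G. cmod (f x * cnj (g x)))"
    unfolding ell2_inner_def by (intro norm_infsum_bound ell2_inner_abs_summable assms)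
  also have "\<dots> \<le> ell2_norm G f * ell2_norm G g"
  proof (rule infsum_le_finite_sums)
    show "(\<lambda>x. cmod (f x * cnj (g x))) summable_on carrier G"
      using ell2_inner_abs_summable[OF assms] .
    fix F assume F: "finite F" "F \<subseteq> carrier G"
    have "(\<Sum>x\<in>F. cmod (f x * cnj (g x))) \<le> L2_set (\<lambda>x. cmod (f x)) F * L2_set (\<lambda>x. cmod (g x)) F"
      using L2_set_mult_ineq[of "\<lambda>x. cmod (f x)" "\<lambda>x. cmod (g x)" F] by (simp add: norm_mult)
    also have "\<dots> \<le> ell2_norm G f * ell2_norm G g"
      by (intro mult_mono L2_set_le_ell2_norm assms F) auto
    finally show "(\<Sum>x\<in>F. cmod (f x * cnj (g x))) \<le> ell2_norm G f * ell2_norm G g" .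
  qed
  finally show ?thesis .
qed

lemma ell2_norm_diff_squared:
  assumes "f \<in> ell2 G" "g \<in> ell2 G"
  shows "(ell2_norm G (\<lambda>x. f x - g x))\<^sup>2 =
    (ell2_norm G f)\<^sup>2 + (ell2_norm G g)\<^sup>2 - 2 * Re (ell2_inner G f g)"
proof -
  have "ell2_inner G (\<lambda>x. f x - g x) (\<lambda>x. f x - g x) =
      ell2_inner G f f - ell2_inner G f g - (cnj (ell2_inner G f g) - ell2_inner G g g)"
    using assms by (simp add: ell2_inner_diff_left ell2_inner_diff_right ell2_diff
        flip: ell2_inner_commute[of G g f])
  then have "Re (of_real ((ell2_norm G (\<lambda>x. f x - g x))\<^sup>2)) =
      Re (ell2_inner G f f - ell2_inner G f g - (cnj (ell2_inner G f g) - ell2_inner G g g))"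
    unfolding ell2_inner_self[OF ell2_diff(1)[OF assms], symmetric] by simp
  then show ?thesis
    by (simp add: ell2_inner_self assms del: of_real_power)
qed

definition ell2_truncate :: "'a set \<Rightarrow> ('a \<Rightarrow> complex) \<Rightarrow> 'a \<Rightarrow> complex"
  where "ell2_truncate F f = (\<lambda>x. \<Sum>b\<in>F. f b * delta b x)"

lemma ell2_truncate_apply: "finite F \<Longrightarrow> ell2_truncate F f x = (if x \<in> F then f x else 0)"
  unfolding ell2_truncate_def by (simp add: indicator_def if_distrib sum.delta cong: if_cong)

lemma ell2_truncate_insert:
  "finite F \<Longrightarrow> b \<notin> F \<Longrightarrow>
    ell2_truncate (insert b F) f = (\<lambda>x. f b * delta b x + ell2_truncate F f x)"
  unfolding ell2_truncate_def by (intro ext) (rule sum.insert)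

lemma ell2_truncate_ell2: "F \<subseteq> carrier G \<Longrightarrow> ell2_truncate F f \<in> ell2 G"
  unfolding ell2_truncate_def by (intro ell2_sum(1) ell2_scale delta_ell2(1)) auto

lemma ell2_norm_diff_truncate:
  assumes "f \<in> ell2 G" "finite F" "F \<subseteq> carrier G"
  shows "(ell2_norm G (\<lambda>x. f x - ell2_truncate F f x))\<^sup>2 =
    (ell2_norm G f)\<^sup>2 - (\<Sum>x\<in>F. (cmod (f x))\<^sup>2)"
proof -
  have inner: "ell2_inner G f (ell2_truncate F f) = of_real (\<Sum>x\<in>F. (cmod (f x))\<^sup>2)"
    unfolding ell2_truncate_def using assms(1,3)
    by (subst ell2_inner_sum_right)
      (auto simp: complex_norm_square[simplified] mult.commute subset_iff intro!: sum.cong)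
  have "ell2_inner G (ell2_truncate F f) (ell2_truncate F f) = of_real (\<Sum>x\<in>F. (cmod (f x))\<^sup>2)"
  proof -
    have "ell2_inner G (ell2_truncate F f) (ell2_truncate F f)
        = ell2_inner G (ell2_truncate F f) (\<lambda>x. \<Sum>b\<in>F. f b * delta b x)"
      by (simp add: ell2_truncate_def)
    also have "\<dots> = (\<Sum>b\<in>F. cnj (f b) * ell2_truncate F f b)"
      using assms(3) by (subst ell2_inner_sum_right) (auto simp: ell2_truncate_ell2 subset_iff)
    also have "\<dots> = of_real (\<Sum>x\<in>F. (cmod (f x))\<^sup>2)"
      using assms(2) by (simp add: ell2_truncate_apply complex_norm_square[simplified] mult.commute)
    finally show ?thesis .
  qed
  then have "(ell2_norm G (ell2_truncate F f))\<^sup>2 = (\<Sum>x\<in>F. (cmod (f x))\<^sup>2)"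
    unfolding ell2_inner_self[OF ell2_truncate_ell2[OF assms(3)]] using of_real_eq_iff by blast
  then show ?thesis
    using ell2_norm_diff_squared[OF assms(1) ell2_truncate_ell2[OF assms(3)], of f]
    unfolding inner by simp
qed

lemma ell2_truncate_approx:
  assumes "f \<in> ell2 G" "0 < e"
  obtains F where "finite F" "F \<subseteq> carrier G"
    "\<And>F'. finite F' \<Longrightarrow> F \<subseteq> F' \<Longrightarrow> F' \<subseteq> carrier G \<Longrightarrow>
       ell2_norm G (\<lambda>x. f x - ell2_truncate F' f x) \<le> e"
proof -
  obtain F where F: "finite F" "F \<subseteq> carrier G"
    "dist (\<Sum>x\<in>F. (cmod (f x))\<^sup>2) (\<Sum>\<^sub>\<infinity>x\<in>carrier G. (cmod (f x))\<^sup>2) \<le> e\<^sup>2"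
    using infsum_finite_approximation[OF ell2D(2)[OF assms(1)], of "e\<^sup>2"] assms(2) by auto
  show ?thesis
  proof (rule that[OF F(1,2)])
    fix F' assume F': "finite F'" "F \<subseteq> F'" "F' \<subseteq> carrier G"
    have "(\<Sum>x\<in>F. (cmod (f x))\<^sup>2) \<le> (\<Sum>x\<in>F'. (cmod (f x))\<^sup>2)"
      using F' by (intro sum_mono2) auto
    then have "(ell2_norm G (\<lambda>x. f x - ell2_truncate F' f x))\<^sup>2 \<le> e\<^sup>2"
      using F(3) sum_le_ell2_norm_squared[OF assms(1) F(1,2)]
      unfolding ell2_norm_diff_truncate[OF assms(1) F'(1,3)] ell2_norm_squared[symmetric] dist_real_def
      by linarith
    then show "ell2_norm G (\<lambda>x. f x - ell2_truncate F' f x) \<le> e"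
      using assms(2) by (simp add: power2_le_iff_abs_le)
  qed
qed

text \<open>A bounded linear functional is determined by its values on point masses, because finitely
  supported vectors are dense.\<close>

lemma ell2_functional_eq_0:
  fixes \<phi> :: "('a \<Rightarrow> complex) \<Rightarrow> complex"
  assumes add: "\<And>f g. f \<in> ell2 G \<Longrightarrow> g \<in> ell2 G \<Longrightarrow> \<phi> (\<lambda>x. f x + g x) = \<phi> f + \<phi> g"
    and scale: "\<And>c f. f \<in> ell2 G \<Longrightarrow> \<phi> (\<lambda>x. c * f x) = c * \<phi> f"
    and bound: "\<And>f. f \<in> ell2 G \<Longrightarrow> cmod (\<phi> f) \<le> K * ell2_norm G f"
    and delta: "\<And>a. a \<in> carrier G \<Longrightarrow> \<phi> (delta a) = 0"
    and f: "f \<in> ell2 G"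
  shows "\<phi> f = 0"
proof -
  have zero: "\<phi> (\<lambda>x. 0) = 0"
    using scale[OF f, of 0] by simp
  have trunc: "\<phi> (ell2_truncate F f) = 0" if "finite F" "F \<subseteq> carrier G" for F
    using that
  proof (induction F)
    case (insert b F)
    then show ?case
      using add[of "\<lambda>x. f b * delta b x" "ell2_truncate F f"] scale[of "delta b" "f b"]
      by (simp add: ell2_truncate_insert delta ell2_truncate_ell2)
  qed (simp add: ell2_truncate_def zero)
  have "cmod (\<phi> f) \<le> 0 + e" if "0 < e" for e
  proof -
    have "0 < e / (\<bar>K\<bar> + 1)" using that by simp
    then obtain F where F: "finite F" "F \<subseteq> carrier G"
      "ell2_norm G (\<lambda>x. f x - ell2_truncate F f x) \<le> e / (\<bar>K\<bar> + 1)"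
      using ell2_truncate_approx[OF f] by (metis order_refl)
    let ?d = "\<lambda>x. f x - ell2_truncate F f x"
    have d: "?d \<in> ell2 G"
      by (intro ell2_diff f ell2_truncate_ell2 F)
    have "\<phi> f = \<phi> ?d"
      using add[OF d ell2_truncate_ell2[OF F(2)], of f] trunc[OF F(1,2)] by simp
    also have "cmod \<dots> \<le> K * ell2_norm G ?d"
      by (rule bound[OF d])
    also have "\<dots> \<le> (\<bar>K\<bar> + 1) * ell2_norm G ?d"
      by (intro mult_right_mono) auto
    also have "\<dots> \<le> (\<bar>K\<bar> + 1) * (e / (\<bar>K\<bar> + 1))"
      by (intro mult_left_mono F) auto
    finally show ?thesis by simp
  qed
  then have "cmod (\<phi> f) \<le> 0"
    by (rule field_le_epsilon)
  then show ?thesis by simp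
qed

section \<open>Bounded operators and adjoints\<close>
lemma bounded_opsD:
  assumes "T \<in> bounded_ops G"
  shows bounded_ops_closed: "f \<in> ell2 G \<Longrightarrow> T f \<in> ell2 G"
    and bounded_ops_add: "f \<in> ell2 G \<Longrightarrow> g \<in> ell2 G \<Longrightarrow> T (\<lambda>x. f x + g x) = (\<lambda>x. T f x + T g x)"
    and bounded_ops_scale: "f \<in> ell2 G \<Longrightarrow> T (\<lambda>x. c * f x) = (\<lambda>x. c * T f x)"
  using assms by (auto simp: bounded_ops_def)

lemma bounded_ops_bound:
  assumes "T \<in> bounded_ops G"
  obtains C where "0 \<le> C" "\<And>f. f \<in> ell2 G \<Longrightarrow> ell2_norm G (T f) \<le> C * ell2_norm G f"
proof -
  obtain C where C: "\<forall>f\<in>ell2 G. ell2_norm G (T f) \<le> C * ell2_norm G f"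
    using assms by (auto simp: bounded_ops_def)
  show ?thesis
  proof (rule that[of "max C 0"])
    fix f assume "f \<in> ell2 G"
    then have "ell2_norm G (T f) \<le> C * ell2_norm G f" using C by blast
    also have "\<dots> \<le> max C 0 * ell2_norm G f" by (intro mult_right_mono) auto
    finally show "ell2_norm G (T f) \<le> max C 0 * ell2_norm G f" .
  qed simp
qed

lemma bounded_opsI:
  assumes "T \<in> extensional (ell2 G)" "\<And>f. f \<in> ell2 G \<Longrightarrow> T f \<in> ell2 G"
    and "\<And>f g. f \<in> ell2 G \<Longrightarrow> g \<in> ell2 G \<Longrightarrow> T (\<lambda>x. f x + g x) = (\<lambda>x. T f x + T g x)"
    and "\<And>c f. f \<in> ell2 G \<Longrightarrow> T (\<lambda>x. c * f x) = (\<lambda>x. c * T f x)"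
    and "\<And>f. f \<in> ell2 G \<Longrightarrow> ell2_norm G (T f) \<le> C * ell2_norm G f"
  shows "T \<in> bounded_ops G"
proof -
  have "\<exists>C. \<forall>f\<in>ell2 G. ell2_norm G (T f) \<le> C * ell2_norm G f"
    using assms(5) by blast
  then show ?thesis
    using assms(1-4) by (auto simp: bounded_ops_def PiE_def)
qed

lemma bounded_ops_extensional: "T \<in> bounded_ops G \<Longrightarrow> T \<in> extensional (ell2 G)"
  by (auto simp: bounded_ops_def PiE_def)

lemma bounded_ops_ext:
  assumes "S \<in> bounded_ops G" "T \<in> bounded_ops G" "\<And>f. f \<in> ell2 G \<Longrightarrow> S f = T f"
  shows "S = T"
  by (rule extensionalityI[OF assms(1,2)[THEN bounded_ops_extensional] assms(3)])

lemma bounded_ops_diff: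
  assumes "T \<in> bounded_ops G" "f \<in> ell2 G" "g \<in> ell2 G"
  shows "T (\<lambda>x. f x - g x) = (\<lambda>x. T f x - T g x)"
  using bounded_ops_add[OF assms(1,2) ell2_scale[OF assms(3)], of "-1"]
    bounded_ops_scale[OF assms(1,3), of "-1"] by simp

lemma bounded_ops_zero: "T \<in> bounded_ops G \<Longrightarrow> T (\<lambda>x. 0) = (\<lambda>x. 0)"
  using bounded_ops_scale[of T G "\<lambda>x. 0" 0] by simp

lemma bounded_ops_sum:
  assumes "T \<in> bounded_ops G" "\<And>b. b \<in> F \<Longrightarrow> v b \<in> ell2 G"
  shows "T (\<lambda>x. \<Sum>b\<in>F. c b * v b x) = (\<lambda>x. \<Sum>b\<in>F. c b * T (v b) x)"
  using assms(2)
  by (induction F rule: infinite_finite_induct)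
    (auto simp: bounded_ops_zero[OF assms(1)] bounded_ops_add[OF assms(1)]
      bounded_ops_scale[OF assms(1)] ell2_sum(1))

lemma bounded_ops_eq_on_deltas:
  assumes "S \<in> bounded_ops G" "T \<in> bounded_ops G"
    and "\<And>a. a \<in> carrier G \<Longrightarrow> S (delta a) = T (delta a)"
  shows "S = T"
proof (rule bounded_ops_ext[OF assms(1,2)])
  fix f assume f: "f \<in> ell2 G"
  obtain C where C: "\<And>f. f \<in> ell2 G \<Longrightarrow> ell2_norm G (S f) \<le> C * ell2_norm G f"
    using bounded_ops_bound[OF assms(1)] by metis
  obtain D where D: "\<And>f. f \<in> ell2 G \<Longrightarrow> ell2_norm G (T f) \<le> D * ell2_norm G f"
    using bounded_ops_bound[OF assms(2)] by metis
  have "S f y - T f y = 0" for y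
  proof (rule ell2_functional_eq_0[where \<phi> = "\<lambda>f. S f y - T f y" and K = "C + D", OF _ _ _ _ f])
    fix h assume h: "h \<in> ell2 G"
    have "cmod (S h y - T h y) \<le> cmod (S h y) + cmod (T h y)" by (rule norm_triangle_ineq4)
    also have "\<dots> \<le> ell2_norm G (S h) + ell2_norm G (T h)"
      by (intro add_mono norm_apply_le_ell2_norm bounded_ops_closed[OF assms(1)] bounded_ops_closed[OF assms(2)] h)
    also have "\<dots> \<le> (C + D) * ell2_norm G h"
      using C[OF h] D[OF h] by (simp add: algebra_simps)
    finally show "cmod (S h y - T h y) \<le> (C + D) * ell2_norm G h" .
  qed (simp_all add: bounded_ops_add[OF assms(1)] bounded_ops_add[OF assms(2)]
      bounded_ops_scale[OF assms(1)] bounded_ops_scale[OF assms(2)] algebra_simps assms(3))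
  then show "S f = T f" by auto
qed

text \<open>The adjoint has the explicit coordinates \<open>\<langle>g, T \<delta>\<^sub>x\<rangle>\<close>. To see that they are square-summable, let
  \<open>h\<close> be their restriction to a finite set: the sum of squares over that set is
  \<open>\<langle>g, T h\<rangle> \<le> C \<parallel>g\<parallel> \<parallel>h\<parallel>\<close>, and it is also \<open>\<parallel>h\<parallel>\<^sup>2\<close>.\<close>

lemma bounded_ops_adjoint_exists:
  assumes T: "T \<in> bounded_ops G"
  obtains S where "S \<in> bounded_ops G"
    "\<And>f g. f \<in> ell2 G \<Longrightarrow> g \<in> ell2 G \<Longrightarrow> ell2_inner G (T f) g = ell2_inner G f (S g)"
proof -
  obtain C where C: "0 \<le> C" "\<And>f. f \<in> ell2 G \<Longrightarrow> ell2_norm G (T f) \<le> C * ell2_norm G f"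
    using bounded_ops_bound[OF T] by metis
  define S where "S = (\<lambda>g\<in>ell2 G. \<lambda>x. if x \<in> carrier G then ell2_inner G g (T (delta x)) else 0)"
  have S_apply: "S g x = (if x \<in> carrier G then ell2_inner G g (T (delta x)) else 0)"
    if "g \<in> ell2 G" for g x
    using that by (simp add: S_def)
  have Td: "T (delta x) \<in> ell2 G" if "x \<in> carrier G" for x
    using bounded_ops_closed[OF T delta_ell2(1)[OF that]] .
  have bound: "S g \<in> ell2 G" "ell2_norm G (S g) \<le> C * ell2_norm G g" if g: "g \<in> ell2 G" for g
  proof -
    have fin: "(\<Sum>x\<in>F. (cmod (S g x))\<^sup>2) \<le> (C * ell2_norm G g)\<^sup>2" if F: "finite F" "F \<subseteq> carrier G" for F
    proof -
      define h where "h = ell2_truncate F (S g)"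
      define s where "s = (\<Sum>x\<in>F. (cmod (S g x))\<^sup>2)"
      have h: "h \<in> ell2 G"
        unfolding h_def by (rule ell2_truncate_ell2[OF F(2)])
      have "T h = (\<lambda>y. \<Sum>x\<in>F. S g x * T (delta x) y)"
        unfolding h_def ell2_truncate_def using F by (intro bounded_ops_sum[OF T] delta_ell2(1)) auto
      then have "ell2_inner G g (T h) = (\<Sum>x\<in>F. cnj (S g x) * S g x)"
        using F Td g by (simp add: ell2_inner_sum_right subset_iff S_apply)
      also have "\<dots> = of_real s"
        unfolding s_def of_real_sum by (simp only: complex_norm_square mult.commute)
      finally have "s = cmod (ell2_inner G g (T h))"
        by (simp only: norm_of_real) (simp add: s_def sum_nonneg)
      also have "\<dots> \<le> ell2_norm G g * ell2_norm G (T h)"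
        by (intro ell2_Cauchy_Schwarz g bounded_ops_closed[OF T] h)
      also have "\<dots> \<le> ell2_norm G g * (C * ell2_norm G h)"
        by (intro mult_left_mono C h) simp
      finally have 1: "s \<le> C * ell2_norm G g * ell2_norm G h"
        by (simp add: mult_ac)
      have "(ell2_norm G h)\<^sup>2 = s"
      proof -
        have "(\<lambda>x. h x - ell2_truncate F h x) = (\<lambda>x. 0)"
          using F by (auto simp: h_def ell2_truncate_apply)
        then have "0 = (ell2_norm G h)\<^sup>2 - (\<Sum>x\<in>F. (cmod (h x))\<^sup>2)"
          using ell2_norm_diff_truncate[OF h F] by simp
        then show ?thesis
          using F by (simp add: s_def h_def ell2_truncate_apply)
      qed
      then have "ell2_norm G h * ell2_norm G h \<le> C * ell2_norm G g * ell2_norm G h"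
        using 1 by (simp add: power2_eq_square)
      then have "ell2_norm G h \<le> C * ell2_norm G g"
        using C(1) ell2_norm_nonneg[of G h] mult_right_le_imp_le by (cases "ell2_norm G h = 0") fastforce+
      then show ?thesis
        using \<open>(ell2_norm G h)\<^sup>2 = s\<close> by (metis s_def power_mono ell2_norm_nonneg)
    qed
    show "S g \<in> ell2 G" "ell2_norm G (S g) \<le> C * ell2_norm G g"
      using C(1) S_apply[OF g] ell2_finite_bound[of G "S g" "C * ell2_norm G g", OF _ fin] by simp_all
  qed
  have S: "S \<in> bounded_ops G"
  proof (rule bounded_opsI[OF _ bound(1) _ _ bound(2)])
    show "S \<in> extensional (ell2 G)" by (simp add: S_def)
  qed (auto simp: S_apply ell2_add ell2_inner_add_left Td)
  moreover have "ell2_inner G (T f) g = ell2_inner G f (S g)" if f: "f \<in> ell2 G" and g: "g \<in> ell2 G" for f g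
  proof -
    have "ell2_inner G (T f) g - ell2_inner G f (S g) = 0"
    proof (rule ell2_functional_eq_0[where \<phi> = "\<lambda>f. ell2_inner G (T f) g - ell2_inner G f (S g)"
          and K = "2 * C * ell2_norm G g", OF _ _ _ _ f])
      fix h assume h: "h \<in> ell2 G"
      have "cmod (ell2_inner G (T h) g - ell2_inner G h (S g)) \<le>
          cmod (ell2_inner G (T h) g) + cmod (ell2_inner G h (S g))"
        by (rule norm_triangle_ineq4)
      also have "\<dots> \<le> ell2_norm G (T h) * ell2_norm G g + ell2_norm G h * ell2_norm G (S g)"
        by (intro add_mono ell2_Cauchy_Schwarz bounded_ops_closed[OF T] bound h g)
      also have "\<dots> \<le> C * ell2_norm G h * ell2_norm G g + ell2_norm G h * (C * ell2_norm G g)"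
        by (intro add_mono mult_right_mono mult_left_mono C bound h g) auto
      finally show "cmod (ell2_inner G (T h) g - ell2_inner G h (S g)) \<le>
          2 * C * ell2_norm G g * ell2_norm G h"
        by (simp add: algebra_simps)
    next
      fix a assume a: "a \<in> carrier G"
      show "ell2_inner G (T (delta a)) g - ell2_inner G (delta a) (S g) = 0"
        using a g by (simp add: S_apply flip: ell2_inner_commute[of G "T (delta a)" g])
    qed (simp_all add: bounded_ops_add[OF T] bounded_ops_scale[OF T] bounded_ops_closed[OF T]
        ell2_inner_add_left bound g algebra_simps)
    then show ?thesis by simp
  qed
  ultimately show ?thesis using that by blast
qed

lemma op_adjoint_eqI:
  assumes "S \<in> bounded_ops G"
    "\<And>f g. f \<in> ell2 G \<Longrightarrow> g \<in> ell2 G \<Longrightarrow> ell2_inner G (T f) g = ell2_inner G f (S g)"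
  shows "op_adjoint G T = S"
  unfolding op_adjoint_def
proof (rule the_equality)
  show "S \<in> bounded_ops G \<and> (\<forall>f\<in>ell2 G. \<forall>g\<in>ell2 G. ell2_inner G (T f) g = ell2_inner G f (S g))"
    using assms by blast
  fix S' assume S': "S' \<in> bounded_ops G \<and>
    (\<forall>f\<in>ell2 G. \<forall>g\<in>ell2 G. ell2_inner G (T f) g = ell2_inner G f (S' g))"
  show "S' = S"
  proof (rule bounded_ops_ext[OF _ assms(1)])
    fix g assume g: "g \<in> ell2 G"
    have "S' g x = S g x" for x
    proof (cases "x \<in> carrier G")
      case True
      have "ell2_inner G (delta x) (S' g) = ell2_inner G (delta x) (S g)"
        using S' assms(2) g True by (metis delta_ell2(1))
      then show ?thesis using True by simp
    next
      case False
      then show ?thesis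
        using S' assms(1) g by (metis bounded_ops_closed ell2D(1))
    qed
    then show "S' g = S g" by blast
  qed (use S' in blast)
qed

lemma op_adjoint_bounded:
  assumes "T \<in> bounded_ops G"
  shows "op_adjoint G T \<in> bounded_ops G"
    and op_adjoint_inner: "f \<in> ell2 G \<Longrightarrow> g \<in> ell2 G \<Longrightarrow>
      ell2_inner G (T f) g = ell2_inner G f (op_adjoint G T g)"
proof -
  obtain S where S: "S \<in> bounded_ops G"
    "\<And>f g. f \<in> ell2 G \<Longrightarrow> g \<in> ell2 G \<Longrightarrow> ell2_inner G (T f) g = ell2_inner G f (S g)"
    using bounded_ops_adjoint_exists[OF assms] by metis
  have eq: "op_adjoint G T = S" by (rule op_adjoint_eqI[OF S])
  show "op_adjoint G T \<in> bounded_ops G"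
    and "f \<in> ell2 G \<Longrightarrow> g \<in> ell2 G \<Longrightarrow> ell2_inner G (T f) g = ell2_inner G f (op_adjoint G T g)"
    unfolding eq using S by auto
qed

lemma op_adjoint_inner_left:
  assumes "T \<in> bounded_ops G" "f \<in> ell2 G" "g \<in> ell2 G"
  shows "ell2_inner G (op_adjoint G T f) g = ell2_inner G f (T g)"
  using op_adjoint_inner[OF assms(1,3,2)] by (metis ell2_inner_commute)

lemma op_adjoint_adjoint: "T \<in> bounded_ops G \<Longrightarrow> op_adjoint G (op_adjoint G T) = T"
  by (rule op_adjoint_eqI) (auto intro: op_adjoint_inner_left)

lemma op_compose_apply: "f \<in> ell2 G \<Longrightarrow> op_compose G S T f = S (T f)"
  by (simp add: compose_eq)

lemma op_compose_bounded:
  assumes "S \<in> bounded_ops G" "T \<in> bounded_ops G"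
  shows "op_compose G S T \<in> bounded_ops G"
proof -
  obtain C where C: "0 \<le> C" "\<And>f. f \<in> ell2 G \<Longrightarrow> ell2_norm G (S f) \<le> C * ell2_norm G f"
    using bounded_ops_bound[OF assms(1)] by metis
  obtain D where D: "0 \<le> D" "\<And>f. f \<in> ell2 G \<Longrightarrow> ell2_norm G (T f) \<le> D * ell2_norm G f"
    using bounded_ops_bound[OF assms(2)] by metis
  show ?thesis
  proof (rule bounded_opsI)
    fix f assume f: "f \<in> ell2 G"
    have "ell2_norm G (S (T f)) \<le> C * ell2_norm G (T f)"
      by (intro C bounded_ops_closed[OF assms(2)] f)
    also have "\<dots> \<le> C * (D * ell2_norm G f)"
      by (intro mult_left_mono C D f)
    finally show "ell2_norm G (op_compose G S T f) \<le> (C * D) * ell2_norm G f"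
      using f by (simp add: op_compose_apply)
  qed (simp_all add: op_compose_apply ell2_add bounded_ops_closed[OF assms(1)] bounded_ops_closed[OF assms(2)]
      bounded_ops_add[OF assms(1)] bounded_ops_add[OF assms(2)]
      bounded_ops_scale[OF assms(1)] bounded_ops_scale[OF assms(2)] compose_def)
qed

lemma op_compose_assoc:
  assumes "R \<in> bounded_ops G" "S \<in> bounded_ops G" "T \<in> bounded_ops G"
  shows "op_compose G (op_compose G R S) T = op_compose G R (op_compose G S T)"
  by (rule bounded_ops_ext) (auto intro!: op_compose_bounded assms
      simp: op_compose_apply bounded_ops_closed[OF assms(3)])

lemma op_adjoint_compose:
  assumes "S \<in> bounded_ops G" "T \<in> bounded_ops G"
  shows "op_adjoint G (op_compose G S T) = op_compose G (op_adjoint G T) (op_adjoint G S)"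
  by (rule op_adjoint_eqI) (auto intro!: op_compose_bounded op_adjoint_bounded assms
      simp: op_compose_apply op_adjoint_inner[OF assms(1)] op_adjoint_inner[OF assms(2)]
        bounded_ops_closed[OF assms(2)] bounded_ops_closed[OF op_adjoint_bounded(1)[OF assms(1)]])

lemma op_scalar_apply: "f \<in> ell2 G \<Longrightarrow> op_scalar G c f = (\<lambda>x. c * f x)"
  by (simp add: op_scalar_def)

lemma op_scalar_bounded: "op_scalar G c \<in> bounded_ops G"
proof (rule bounded_opsI)
  show "op_scalar G c \<in> extensional (ell2 G)" by (simp add: op_scalar_def)
qed (auto simp: op_scalar_apply ell2_add algebra_simps)

lemma op_adjoint_scalar: "op_adjoint G (op_scalar G c) = op_scalar G (cnj c)"
  by (rule op_adjoint_eqI) (auto simp: op_scalar_apply op_scalar_bounded)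

lemma op_compose_scalar: "op_compose G (op_scalar G c) (op_scalar G d) = op_scalar G (c * d)"
  by (rule bounded_ops_ext) (auto simp: op_scalar_apply op_compose_apply intro!: op_compose_bounded op_scalar_bounded)

lemma op_scalar_commute:
  assumes "T \<in> bounded_ops G"
  shows "op_compose G (op_scalar G c) T = op_compose G T (op_scalar G c)"
  by (rule bounded_ops_ext)
    (auto simp: op_scalar_apply op_compose_apply bounded_ops_closed[OF assms] bounded_ops_scale[OF assms]
      intro!: op_compose_bounded op_scalar_bounded assms)

lemma op_scalar_1 [simp]:
  assumes "T \<in> bounded_ops G"
  shows "op_compose G (op_scalar G 1) T = T" "op_compose G T (op_scalar G 1) = T"
  using bounded_ops_ext[OF op_compose_bounded[OF op_scalar_bounded[of G 1] assms] assms]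
    bounded_ops_ext[OF op_compose_bounded[OF assms op_scalar_bounded[of G 1]] assms]
  by (auto simp: op_compose_apply op_scalar_apply bounded_ops_closed[OF assms])

lemma commutant_compose:
  assumes "S \<in> commutant G A" "T \<in> commutant G A" "A \<subseteq> bounded_ops G"
  shows "op_compose G S T \<in> commutant G A"
proof -
  have ST: "S \<in> bounded_ops G" "T \<in> bounded_ops G"
    using assms by (auto simp: commutant_def)
  have "op_compose G (op_compose G S T) R = op_compose G R (op_compose G S T)" if R: "R \<in> A" for R
  proof -
    have R': "R \<in> bounded_ops G" using R assms(3) by blast
    have "op_compose G (op_compose G S T) R = op_compose G S (op_compose G R T)"
      using assms(2) R ST R' by (simp add: op_compose_assoc commutant_def)
    also have "\<dots> = op_compose G R (op_compose G S T)"
      using assms(1) R ST R' by (simp add: op_compose_assoc[symmetric] commutant_def)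
    finally show ?thesis .
  qed
  then show ?thesis
    using ST by (simp add: commutant_def op_compose_bounded)
qed

lemma commutant_adjoint:
  assumes "T \<in> commutant G A" "A \<subseteq> bounded_ops G" "\<And>S. S \<in> A \<Longrightarrow> op_adjoint G S \<in> A"
  shows "op_adjoint G T \<in> commutant G A"
proof -
  have T: "T \<in> bounded_ops G" using assms by (simp add: commutant_def)
  have "op_compose G (op_adjoint G T) S = op_compose G S (op_adjoint G T)" if S: "S \<in> A" for S
  proof -
    have S': "S \<in> bounded_ops G" "op_adjoint G S \<in> bounded_ops G" using S assms(2,3) by blast+
    have "op_compose G T (op_adjoint G S) = op_compose G (op_adjoint G S) T"
      using assms(1,3) S by (simp add: commutant_def)
    then have "op_adjoint G (op_compose G T (op_adjoint G S)) = op_adjoint G (op_compose G (op_adjoint G S) T)"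
      by simp
    then show ?thesis
      using S' T by (simp add: op_adjoint_compose op_adjoint_adjoint)
  qed
  then show ?thesis
    using T by (simp add: commutant_def op_adjoint_bounded)
qed

lemma commutant_scalar: "A \<subseteq> bounded_ops G \<Longrightarrow> op_scalar G c \<in> commutant G A"
  by (auto simp: commutant_def op_scalar_bounded op_scalar_commute)

section \<open>The group von Neumann algebra and its unitary group\<close>
lemma op_diff_apply: "f \<in> ell2 G \<Longrightarrow> op_diff G S T f = (\<lambda>x. S f x - T f x)"
  by (simp add: op_diff_def)

lemma op_diff_bounded:
  assumes "S \<in> bounded_ops G" "T \<in> bounded_ops G"
  shows "op_diff G S T \<in> bounded_ops G"
proof -
  obtain C where C: "\<And>f. f \<in> ell2 G \<Longrightarrow> ell2_norm G (S f) \<le> C * ell2_norm G f"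
    using bounded_ops_bound[OF assms(1)] by metis
  obtain D where D: "\<And>f. f \<in> ell2 G \<Longrightarrow> ell2_norm G (T f) \<le> D * ell2_norm G f"
    using bounded_ops_bound[OF assms(2)] by metis
  show ?thesis
  proof (rule bounded_opsI)
    show "op_diff G S T \<in> extensional (ell2 G)" by (simp add: op_diff_def)
    fix f assume f: "f \<in> ell2 G"
    have "ell2_norm G (\<lambda>x. S f x - T f x) \<le> ell2_norm G (S f) + ell2_norm G (T f)"
      by (intro ell2_diff bounded_ops_closed[OF assms(1)] bounded_ops_closed[OF assms(2)] f)
    also have "\<dots> \<le> (C + D) * ell2_norm G f"
      using C[OF f] D[OF f] by (simp add: distrib_right)
    finally show "ell2_norm G (op_diff G S T f) \<le> (C + D) * ell2_norm G f"
      by (simp add: op_diff_apply f)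
    show "op_diff G S T f \<in> ell2 G"
      by (simp add: op_diff_apply f ell2_diff bounded_ops_closed[OF assms(1)] bounded_ops_closed[OF assms(2)])
  qed (auto simp: op_diff_apply ell2_add bounded_ops_add[OF assms(1)] bounded_ops_add[OF assms(2)]
      bounded_ops_scale[OF assms(1)] bounded_ops_scale[OF assms(2)] right_diff_distrib)
qed

lemma ell2_norm_phase_diff:
  assumes "f \<in> ell2 G" "g \<in> ell2 G" "ell2_norm G f = 1" "ell2_norm G g = 1" "cmod c = 1"
  shows "(ell2_norm G (\<lambda>x. c * f x - g x))\<^sup>2 = 2 - 2 * Re (c * ell2_inner G f g)"
    and ell2_norm_phase_diff_ge: "sqrt (2 - 2 * cmod (ell2_inner G f g)) \<le> ell2_norm G (\<lambda>x. c * f x - g x)"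
proof -
  show eq: "(ell2_norm G (\<lambda>x. c * f x - g x))\<^sup>2 = 2 - 2 * Re (c * ell2_inner G f g)"
    using ell2_norm_diff_squared[OF ell2_scale[OF assms(1)] assms(2), of c] assms(3-5) by simp
  have "Re (c * ell2_inner G f g) \<le> cmod (ell2_inner G f g)"
    using complex_Re_le_cmod[of "c * ell2_inner G f g"] assms(5) by (simp add: norm_mult)
  then show "sqrt (2 - 2 * cmod (ell2_inner G f g)) \<le> ell2_norm G (\<lambda>x. c * f x - g x)"
    using eq by (intro real_le_lsqrt) auto
qed

text \<open>The best phase rotates the inner product to the nonnegative real axis.\<close>

lemma ell2_norm_phase_diff_attained:
  assumes "f \<in> ell2 G" "g \<in> ell2 G" "ell2_norm G f = 1" "ell2_norm G g = 1"
  obtains c where "cmod c = 1"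
    "ell2_norm G (\<lambda>x. c * f x - g x) = sqrt (2 - 2 * cmod (ell2_inner G f g))"
proof -
  define z where "z = ell2_inner G f g"
  obtain c where c: "cmod c = 1" "c * z = of_real (cmod z)"
  proof (cases "z = 0")
    case True
    then show ?thesis using that[of 1] by simp
  next
    case False
    then show ?thesis
      using that[of "cnj z / of_real (cmod z)"]
      by (simp add: norm_divide mult.commute[of "cnj z"] complex_norm_square[symmetric, simplified]
          power2_eq_square)
  qed
  have "(ell2_norm G (\<lambda>x. c * f x - g x))\<^sup>2 = 2 - 2 * cmod z"
    using ell2_norm_phase_diff(1)[OF assms c(1)] unfolding z_def[symmetric] c(2) by simp
  then have "ell2_norm G (\<lambda>x. c * f x - g x) = sqrt (2 - 2 * cmod z)"
    by (metis ell2_norm_nonneg real_sqrt_unique)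
  then show ?thesis
    using that c(1) by (simp add: z_def)
qed

context group begin

lemma bij_left_translation: "g \<in> carrier G \<Longrightarrow> bij_betw (\<lambda>x. g \<otimes> x) (carrier G) (carrier G)"
  by (rule bij_betw_byWitness[where f' = "\<lambda>x. inv g \<otimes> x"]) (auto simp flip: m_assoc)

lemma bij_right_translation: "g \<in> carrier G \<Longrightarrow> bij_betw (\<lambda>x. x \<otimes> g) (carrier G) (carrier G)"
  by (rule bij_betw_byWitness[where f' = "\<lambda>x. x \<otimes> inv g"]) (auto simp: m_assoc)

lemma ell2_reindex:
  assumes "bij_betw \<pi> (carrier G) (carrier G)" "f \<in> ell2 G"
  shows "(\<lambda>x. if x \<in> carrier G then f (\<pi> x) else 0) \<in> ell2 G"
    and "ell2_norm G (\<lambda>x. if x \<in> carrier G then f (\<pi> x) else 0) = ell2_norm G f"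
proof -
  have "(\<lambda>x. (cmod (f (\<pi> x)))\<^sup>2) summable_on carrier G"
    using ell2D(2)[OF assms(2)] summable_on_reindex_bij_betw[OF assms(1), of "\<lambda>x. (cmod (f x))\<^sup>2"] by simp
  then show "(\<lambda>x. if x \<in> carrier G then f (\<pi> x) else 0) \<in> ell2 G"
    by (auto simp: ell2_def cong: summable_on_cong)
  show "ell2_norm G (\<lambda>x. if x \<in> carrier G then f (\<pi> x) else 0) = ell2_norm G f"
    using infsum_reindex_bij_betw[OF assms(1), of "\<lambda>x. (cmod (f x))\<^sup>2"]
    by (simp add: ell2_norm_def cong: infsum_cong)
qed

text \<open>The inverse is placed so that \<open>\<delta>\<^sub>b\<close> is sent to \<open>\<delta>\<^sub>b\<^sub>a\<close>; this makes \<open>a\<close> act by an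
  anti-homomorphism.\<close>

definition right_regular :: "'a \<Rightarrow> 'a ell2_op"
  where "right_regular a = (\<lambda>f\<in>ell2 G. \<lambda>x. if x \<in> carrier G then f (x \<otimes> inv a) else 0)"

lemma left_regular_apply:
  "f \<in> ell2 G \<Longrightarrow> left_regular G g f = (\<lambda>x. if x \<in> carrier G then f (inv g \<otimes> x) else 0)"
  by (simp add: left_regular_def)

lemma right_regular_apply:
  "f \<in> ell2 G \<Longrightarrow> right_regular a f = (\<lambda>x. if x \<in> carrier G then f (x \<otimes> inv a) else 0)"
  by (simp add: right_regular_def)

lemma left_regular_bounded: "g \<in> carrier G \<Longrightarrow> left_regular G g \<in> bounded_ops G"
  and left_regular_norm: "g \<in> carrier G \<Longrightarrow> f \<in> ell2 G \<Longrightarrow> ell2_norm G (left_regular G g f) = ell2_norm G f"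
proof -
  assume g: "g \<in> carrier G"
  note re = ell2_reindex[OF bij_left_translation[OF inv_closed[OF g]]]
  show n: "ell2_norm G (left_regular G g f) = ell2_norm G f" if "f \<in> ell2 G" for f
    using re[OF that] that by (simp add: left_regular_apply)
  show "left_regular G g \<in> bounded_ops G"
  proof (rule bounded_opsI[where C = 1])
    show "left_regular G g \<in> extensional (ell2 G)" by (simp add: left_regular_def)
  qed (use re n in \<open>auto simp: left_regular_apply ell2_add\<close>)
qed

lemma right_regular_bounded: "a \<in> carrier G \<Longrightarrow> right_regular a \<in> bounded_ops G"
  and right_regular_norm: "a \<in> carrier G \<Longrightarrow> f \<in> ell2 G \<Longrightarrow> ell2_norm G (right_regular a f) = ell2_norm G f"
proof -
  assume g: "a \<in> carrier G"
  note re = ell2_reindex[OF bij_right_translation[OF inv_closed[OF g]]]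
  show n: "ell2_norm G (right_regular a f) = ell2_norm G f" if "f \<in> ell2 G" for f
    using re[OF that] that by (simp add: right_regular_apply)
  show "right_regular a \<in> bounded_ops G"
  proof (rule bounded_opsI[where C = 1])
    show "right_regular a \<in> extensional (ell2 G)" by (simp add: right_regular_def)
  qed (use re n in \<open>auto simp: right_regular_apply ell2_add\<close>)
qed

lemma left_regular_delta:
  assumes "g \<in> carrier G" "a \<in> carrier G"
  shows "left_regular G g (delta a) = delta (g \<otimes> a)"
proof -
  have "inv g \<otimes> x = a \<longleftrightarrow> x = g \<otimes> a" if "x \<in> carrier G" for x
    using assms that by (metis inv_solve_left inv_closed inv_inv)
  then show ?thesis
    using assms by (auto simp: left_regular_apply indicator_def fun_eq_iff)
qed

lemma right_regular_delta:
  assumes "g \<in> carrier G" "a \<in> carrier G"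
  shows "right_regular g (delta a) = delta (a \<otimes> g)"
proof -
  have "x \<otimes> inv g = a \<longleftrightarrow> x = a \<otimes> g" if "x \<in> carrier G" for x
    using assms that by (metis inv_solve_right inv_closed inv_inv)
  then show ?thesis
    using assms by (auto simp: right_regular_apply indicator_def fun_eq_iff)
qed

lemma op_compose_eqI_deltas:
  assumes "S \<in> bounded_ops G" "T \<in> bounded_ops G" "S' \<in> bounded_ops G" "T' \<in> bounded_ops G"
    and "\<And>a. a \<in> carrier G \<Longrightarrow> S (T (delta a)) = S' (T' (delta a))"
  shows "op_compose G S T = op_compose G S' T'"
  by (rule bounded_ops_eq_on_deltas) (auto intro!: op_compose_bounded assms simp: op_compose_apply)

lemma left_regular_mult:
  assumes "g \<in> carrier G" "h \<in> carrier G"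
  shows "op_compose G (left_regular G g) (left_regular G h) = left_regular G (g \<otimes> h)"
  by (rule bounded_ops_eq_on_deltas)
    (auto intro!: op_compose_bounded left_regular_bounded assms
      simp: op_compose_apply left_regular_delta assms m_assoc)

lemma left_regular_one: "left_regular G \<one> = op_scalar G 1"
  by (rule bounded_ops_eq_on_deltas)
    (auto intro!: left_regular_bounded op_scalar_bounded simp: left_regular_delta op_scalar_apply)

lemma left_regular_adjoint:
  assumes g: "g \<in> carrier G"
  shows "op_adjoint G (left_regular G g) = left_regular G (inv g)"
proof (rule op_adjoint_eqI[OF left_regular_bounded[OF inv_closed[OF g]]])
  fix f h assume f: "f \<in> ell2 G" and h: "h \<in> ell2 G"
  have "ell2_inner G (left_regular G g f) h = (\<Sum>\<^sub>\<infinity>x\<in>carrier G. f (inv g \<otimes> x) * cnj (h x))"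
    by (simp add: ell2_inner_def left_regular_apply f cong: infsum_cong)
  also have "\<dots> = (\<Sum>\<^sub>\<infinity>x\<in>carrier G. f (inv g \<otimes> (g \<otimes> x)) * cnj (h (g \<otimes> x)))"
    by (rule infsum_reindex_bij_betw[OF bij_left_translation[OF g], symmetric])
  also have "\<dots> = ell2_inner G f (left_regular G (inv g) h)"
    using g by (simp add: ell2_inner_def left_regular_apply h cong: infsum_cong)
  finally show "ell2_inner G (left_regular G g f) h = ell2_inner G f (left_regular G (inv g) h)" .
qed

lemma left_regular_image_bounded: "left_regular G ` carrier G \<subseteq> bounded_ops G"
  using left_regular_bounded by blast

abbreviation "regular_commutant \<equiv> commutant G (left_regular G ` carrier G)"

lemma commutant_image_bounded: "commutant G A \<subseteq> bounded_ops G"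
  by (auto simp: commutant_def)

lemma vN_bounded: "u \<in> group_vN_algebra G \<Longrightarrow> u \<in> bounded_ops G"
  by (simp add: group_vN_algebra_def commutant_def)

lemma vN_compose:
  "u \<in> group_vN_algebra G \<Longrightarrow> v \<in> group_vN_algebra G \<Longrightarrow> op_compose G u v \<in> group_vN_algebra G"
  unfolding group_vN_algebra_def by (rule commutant_compose[OF _ _ commutant_image_bounded])

lemma vN_adjoint:
  assumes "u \<in> group_vN_algebra G"
  shows "op_adjoint G u \<in> group_vN_algebra G"
  using assms unfolding group_vN_algebra_def
proof (rule commutant_adjoint[OF _ commutant_image_bounded])
  fix S assume "S \<in> regular_commutant"
  then show "op_adjoint G S \<in> regular_commutant"
    by (rule commutant_adjoint[OF _ left_regular_image_bounded]) (auto simp: left_regular_adjoint)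
qed

lemma vN_scalar: "op_scalar G c \<in> group_vN_algebra G"
  unfolding group_vN_algebra_def by (rule commutant_scalar[OF commutant_image_bounded])

lemma vN_left_regular: "g \<in> carrier G \<Longrightarrow> left_regular G g \<in> group_vN_algebra G"
  by (auto simp: group_vN_algebra_def commutant_def left_regular_bounded)

lemma right_regular_commutant:
  assumes a: "a \<in> carrier G"
  shows "right_regular a \<in> regular_commutant"
proof -
  have "op_compose G (right_regular a) (left_regular G g) = op_compose G (left_regular G g) (right_regular a)"
    if g: "g \<in> carrier G" for g
    by (rule op_compose_eqI_deltas)
      (auto simp: left_regular_bounded right_regular_bounded left_regular_delta right_regular_delta
        a g m_assoc)
  then show ?thesis
    by (auto simp: commutant_def right_regular_bounded a)
qed

text \<open>Right translations lie in the commutant of the left regular representation, so elements of the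
  von Neumann algebra commute with them.\<close>

lemma vN_delta:
  assumes u: "u \<in> group_vN_algebra G" and a: "a \<in> carrier G"
  shows "u (delta a) = right_regular a (u (delta \<one>))"
proof -
  have "u (delta a) = u (right_regular a (delta \<one>))"
    using a by (simp add: right_regular_delta)
  also have "\<dots> = op_compose G u (right_regular a) (delta \<one>)"
    by (simp add: op_compose_apply)
  also have "op_compose G u (right_regular a) = op_compose G (right_regular a) u"
    using u right_regular_commutant[OF a] by (simp add: group_vN_algebra_def commutant_def)
  also have "\<dots> (delta \<one>) = right_regular a (u (delta \<one>))"
    by (simp add: op_compose_apply)
  finally show ?thesis .
qed

text \<open>An element of the von Neumann algebra is determined by its value at \<open>\<delta>\<^sub>1\<close>, since right translation
  carries this value to the values at all point masses.\<close>

lemma vN_separating: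
  assumes "u \<in> group_vN_algebra G" "v \<in> group_vN_algebra G" "u (delta \<one>) = v (delta \<one>)"
  shows "u = v"
proof (rule bounded_ops_eq_on_deltas[OF vN_bounded[OF assms(1)] vN_bounded[OF assms(2)]])
  fix a assume "a \<in> carrier G"
  then show "u (delta a) = v (delta a)"
    using vN_delta[OF assms(1)] vN_delta[OF assms(2)] assms(3) by metis
qed

abbreviation "U \<equiv> unitary_group G"

lemma unitary_simps [simp]:
  "u \<otimes>\<^bsub>U\<^esub> v = op_compose G u v" "\<one>\<^bsub>U\<^esub> = op_scalar G 1"
  by (simp_all add: unitary_group_def)

lemma unitaryD:
  assumes "u \<in> carrier U"
  shows unitary_vN: "u \<in> group_vN_algebra G" and unitary_bounded: "u \<in> bounded_ops G"
    and unitary_adjoint_compose: "op_compose G (op_adjoint G u) u = op_scalar G 1"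
    and unitary_compose_adjoint: "op_compose G u (op_adjoint G u) = op_scalar G 1"
  using assms by (auto simp: unitary_group_def vN_bounded)

lemma unitaryI:
  "u \<in> group_vN_algebra G \<Longrightarrow> op_compose G (op_adjoint G u) u = op_scalar G 1 \<Longrightarrow>
    op_compose G u (op_adjoint G u) = op_scalar G 1 \<Longrightarrow> u \<in> carrier U"
  by (simp add: unitary_group_def)

lemma unitary_adjoint:
  assumes u: "u \<in> carrier U"
  shows "op_adjoint G u \<in> carrier U"
  using unitaryD[OF u] by (intro unitaryI vN_adjoint) (auto simp: op_adjoint_adjoint)

lemma unitary_compose:
  assumes u: "u \<in> carrier U" and v: "v \<in> carrier U"
  shows "op_compose G u v \<in> carrier U"
proof (rule unitaryI)
  note u' = unitaryD[OF u] and v' = unitaryD[OF v]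
  note u'' = unitaryD[OF unitary_adjoint[OF u]] and v'' = unitaryD[OF unitary_adjoint[OF v]]
  show "op_compose G u v \<in> group_vN_algebra G"
    by (rule vN_compose[OF u'(1) v'(1)])
  have "op_compose G (op_adjoint G (op_compose G u v)) (op_compose G u v) =
      op_compose G (op_adjoint G v) (op_compose G (op_compose G (op_adjoint G u) u) v)"
    using u'(2) v'(2) u''(2) v''(2) by (simp only: op_adjoint_compose op_compose_assoc op_compose_bounded)
  then show "op_compose G (op_adjoint G (op_compose G u v)) (op_compose G u v) = op_scalar G 1"
    using u' v' by simp
  have "op_compose G (op_compose G u v) (op_adjoint G (op_compose G u v)) =
      op_compose G u (op_compose G (op_compose G v (op_adjoint G v)) (op_adjoint G u))"
    using u'(2) v'(2) u''(2) v''(2) by (simp only: op_adjoint_compose op_compose_assoc op_compose_bounded)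
  then show "op_compose G (op_compose G u v) (op_adjoint G (op_compose G u v)) = op_scalar G 1"
    using u' v' u'' by simp
qed

lemma unitary_scalar: "cmod c = 1 \<Longrightarrow> op_scalar G c \<in> carrier U"
  by (intro unitaryI vN_scalar)
    (simp_all add: op_adjoint_scalar op_compose_scalar complex_norm_square[symmetric, simplified] mult.commute[of "cnj c"])

lemma unitary_left_regular: "g \<in> carrier G \<Longrightarrow> left_regular G g \<in> carrier U"
  by (intro unitaryI vN_left_regular)
    (simp_all add: left_regular_adjoint left_regular_mult left_regular_one)

lemma unitary_group_is_group: "group U"
proof (rule groupI)
  fix u assume u: "u \<in> carrier U"
  show "\<exists>v\<in>carrier U. v \<otimes>\<^bsub>U\<^esub> u = \<one>\<^bsub>U\<^esub>"
    using unitary_adjoint[OF u] unitary_adjoint_compose[OF u] by auto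
qed (auto simp: unitary_compose unitary_scalar op_compose_assoc unitary_bounded)

lemma unitary_inv:
  assumes "u \<in> carrier U"
  shows "inv\<^bsub>U\<^esub> u = op_adjoint G u"
  using group.inv_equality[OF unitary_group_is_group _ assms unitary_adjoint[OF assms]]
    unitary_adjoint_compose[OF assms] by simp

lemma unitary_norm:
  assumes u: "u \<in> carrier U" and f: "f \<in> ell2 G"
  shows "ell2_norm G (u f) = ell2_norm G f"
proof -
  have uf: "u f \<in> ell2 G" by (rule bounded_ops_closed[OF unitary_bounded[OF u] f])
  have "ell2_inner G (u f) (u f) = ell2_inner G f (op_adjoint G u (u f))"
    by (rule op_adjoint_inner[OF unitary_bounded[OF u] f uf])
  also have "op_adjoint G u (u f) = f"
    using fun_cong[OF unitary_adjoint_compose[OF u], of f] f by (simp add: op_compose_apply op_scalar_apply)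
  finally have "(ell2_norm G (u f))\<^sup>2 = (ell2_norm G f)\<^sup>2"
    unfolding ell2_inner_self[OF uf] ell2_inner_self[OF f] using of_real_eq_iff by blast
  then show ?thesis by (simp add: power2_eq_iff_nonneg)
qed

lemma unitary_delta_unit:
  assumes "u \<in> carrier U"
  shows "u (delta \<one>) \<in> ell2 G" "ell2_norm G (u (delta \<one>)) = 1"
  using bounded_ops_closed[OF unitary_bounded[OF assms]] unitary_norm[OF assms]
  by (auto simp: ell2_norm_delta)

lemma circle_normal: "circle_subgroup G \<lhd> U"
proof -
  interpret U: group U by (rule unitary_group_is_group)
  show ?thesis
  proof (rule U.normalI)
    show "subgroup (circle_subgroup G) U"
    proof (rule U.subgroupI)
      fix u assume "u \<in> circle_subgroup G"
      then obtain c where c: "cmod c = 1" "u = op_scalar G c" by (auto simp: circle_subgroup_def)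
      then show "inv\<^bsub>U\<^esub> u \<in> circle_subgroup G"
        by (auto simp: circle_subgroup_def unitary_inv unitary_scalar op_adjoint_scalar)
    qed (auto simp: circle_subgroup_def unitary_scalar op_compose_scalar norm_mult
        intro!: imageI exI[of _ "1::complex"])
    show "\<forall>u\<in>carrier U. circle_subgroup G #>\<^bsub>U\<^esub> u = u <#\<^bsub>U\<^esub> circle_subgroup G"
      by (auto simp: r_coset_def l_coset_def circle_subgroup_def op_scalar_commute unitary_bounded)
  qed
qed

end

section \<open>The metric of the projective unitary group\<close>
context group begin

abbreviation "PU \<equiv> proj_unitary_group G"

abbreviation proj_class :: "'a ell2_op \<Rightarrow> 'a ell2_op set"
  where "proj_class u \<equiv> circle_subgroup G #>\<^bsub>U\<^esub> u"

lemma proj_unitary_group_is_group: "group PU"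
  unfolding proj_unitary_group_def by (rule normal.factorgroup_is_group[OF circle_normal])

lemma proj_carrier: "carrier PU = proj_class ` carrier U"
  by (auto simp: proj_unitary_group_def FactGroup_def RCOSETS_def)

lemma proj_class_hom: "group_hom U PU proj_class"
  unfolding proj_unitary_group_def
  by (intro group_hom.intro group_hom_axioms.intro unitary_group_is_group
      normal.factorgroup_is_group[OF circle_normal] normal.r_coset_hom_Mod[OF circle_normal])

lemma mem_proj_class: "v \<in> proj_class u \<longleftrightarrow> (\<exists>c. cmod c = 1 \<and> v = op_compose G (op_scalar G c) u)"
  by (auto simp: r_coset_def circle_subgroup_def)

lemma vN_trace_eq: "vN_trace G u = u (delta \<one>) \<one>"
  by (simp add: vN_trace_def)

lemma vN_norm2_eq:
  assumes T: "T \<in> bounded_ops G"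
  shows "vN_norm2 G T = ell2_norm G (T (delta \<one>))"
proof -
  have Td: "T (delta \<one>) \<in> ell2 G"
    by (rule bounded_ops_closed[OF T]) simp
  have "vN_trace G (op_compose G (op_adjoint G T) T) = of_real ((ell2_norm G (T (delta \<one>)))\<^sup>2)"
    unfolding vN_trace_def ell2_inner_self[OF Td, symmetric]
    by (simp only: op_compose_apply delta_ell2(1)[OF one_closed] op_adjoint_inner_left[OF T Td])
  then show ?thesis
    unfolding vN_norm2_def by simp
qed

text \<open>The 2-norm of \<open>\<lambda> - w\<close> is the distance of the unit vectors \<open>\<lambda> \<delta>\<^sub>1\<close> and \<open>w \<delta>\<^sub>1\<close>; minimising over the
  phase leaves only the absolute value of the trace.\<close>

lemma proj_length_unitary:
  assumes w: "w \<in> carrier U"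
  shows "proj_length G w = sqrt (2 - 2 * cmod (vN_trace G w))"
proof -
  note wd = unitary_delta_unit[OF w]
  have inner: "cmod (ell2_inner G (delta \<one>) (w (delta \<one>))) = cmod (vN_trace G w)"
    by (simp add: vN_trace_eq)
  have eq: "vN_norm2 G (op_diff G (op_scalar G c) w) = ell2_norm G (\<lambda>x. c * delta \<one> x - w (delta \<one>) x)" for c
    by (simp add: vN_norm2_eq op_diff_bounded op_scalar_bounded unitary_bounded w op_diff_apply op_scalar_apply)
  obtain c where c: "cmod c = 1"
    "ell2_norm G (\<lambda>x. c * delta \<one> x - w (delta \<one>) x) = sqrt (2 - 2 * cmod (vN_trace G w))"
    using ell2_norm_phase_diff_attained[OF delta_ell2(1)[OF one_closed] wd(1) ell2_norm_delta wd(2)]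
    unfolding inner by auto
  show ?thesis
    unfolding proj_length_def eq
  proof (rule cInf_eq_minimum)
    show "sqrt (2 - 2 * cmod (vN_trace G w)) \<in>
        (\<lambda>c. ell2_norm G (\<lambda>x. c * delta \<one> x - w (delta \<one>) x)) ` {c. cmod c = 1}"
      using c by (intro image_eqI[of _ _ c]) auto
    fix y assume "y \<in> (\<lambda>c. ell2_norm G (\<lambda>x. c * delta \<one> x - w (delta \<one>) x)) ` {c. cmod c = 1}"
    then show "sqrt (2 - 2 * cmod (vN_trace G w)) \<le> y"
      using ell2_norm_phase_diff_ge[OF delta_ell2(1)[OF one_closed] wd(1) ell2_norm_delta wd(2)]
      unfolding inner by auto
  qed
qed

lemma vN_trace_adjoint_compose:
  assumes u: "u \<in> bounded_ops G" and v: "v \<in> bounded_ops G"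
  shows "vN_trace G (op_compose G (op_adjoint G u) v) = ell2_inner G (v (delta \<one>)) (u (delta \<one>))"
proof -
  have "v (delta \<one>) \<in> ell2 G"
    by (rule bounded_ops_closed[OF v]) simp
  then show ?thesis
    unfolding vN_trace_def by (simp only: op_compose_apply delta_ell2(1)[OF one_closed] op_adjoint_inner_left[OF u])
qed

lemma proj_dist_class:
  assumes u: "u \<in> carrier U" and v: "v \<in> carrier U"
  shows "proj_dist G (proj_class u) (proj_class v) =
    sqrt (2 - 2 * cmod (ell2_inner G (u (delta \<one>)) (v (delta \<one>))))"
proof -
  define r where "r = sqrt (2 - 2 * cmod (ell2_inner G (u (delta \<one>)) (v (delta \<one>))))"
  have "proj_length G (op_compose G (op_adjoint G u') v') = r"
    if uv: "u' \<in> proj_class u" "v' \<in> proj_class v" for u' v'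
  proof -
    obtain c d where cd: "cmod c = 1" "cmod d = 1"
      "u' = op_compose G (op_scalar G c) u" "v' = op_compose G (op_scalar G d) v"
      using uv unfolding mem_proj_class by blast
    have U: "u' \<in> carrier U" "v' \<in> carrier U"
      using cd u v by (auto intro: unitary_compose unitary_scalar)
    have "u' (delta \<one>) = (\<lambda>x. c * u (delta \<one>) x)" "v' (delta \<one>) = (\<lambda>x. d * v (delta \<one>) x)"
      using cd unitary_delta_unit[OF u] unitary_delta_unit[OF v] by (simp_all add: op_compose_apply op_scalar_apply)
    then have "cmod (ell2_inner G (v' (delta \<one>)) (u' (delta \<one>))) =
        cmod (ell2_inner G (u (delta \<one>)) (v (delta \<one>)))"
      using cd(1,2) by (subst ell2_inner_commute) (simp add: norm_mult)
    then show ?thesis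
      unfolding r_def using U
      by (simp add: proj_length_unitary unitary_compose unitary_adjoint vN_trace_adjoint_compose unitary_bounded)
  qed
  moreover have "u \<in> proj_class u" "v \<in> proj_class v"
    using group.rcos_self[OF unitary_group_is_group _ normal_imp_subgroup[OF circle_normal]] u v by auto
  ultimately have "{proj_length G (op_compose G (op_adjoint G u') v') |u' v'.
      u' \<in> proj_class u \<and> v' \<in> proj_class v} = {r}"
    by blast
  then show ?thesis
    unfolding proj_dist_def r_def[symmetric] proj_carrier using u v by simp
qed

lemma overlap_le_1:
  assumes u: "u \<in> carrier U" and v: "v \<in> carrier U"
  shows "cmod (ell2_inner G (u (delta \<one>)) (v (delta \<one>))) \<le> 1"
  using ell2_Cauchy_Schwarz[OF unitary_delta_unit(1)[OF u] unitary_delta_unit(1)[OF v]]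
    unitary_delta_unit(2)[OF u] unitary_delta_unit(2)[OF v] by simp

text \<open>Equality in the Cauchy-Schwarz inequality: unit vectors with overlap 1 differ by a phase, and
  \<open>\<delta>\<^sub>1\<close> separates the algebra.\<close>

lemma proj_class_eq_iff:
  assumes u: "u \<in> carrier U" and v: "v \<in> carrier U"
  shows "proj_class u = proj_class v \<longleftrightarrow> cmod (ell2_inner G (u (delta \<one>)) (v (delta \<one>))) = 1"
proof
  note u' = unitary_delta_unit[OF u] and v' = unitary_delta_unit[OF v]
  interpret UG: group U by (rule unitary_group_is_group)
  note C = normal_imp_subgroup[OF circle_normal]
  {
    assume "proj_class u = proj_class v"
    then have "u \<in> proj_class v" using UG.rcos_self[OF u C] by simp
    then obtain c where c: "cmod c = 1" "u = op_compose G (op_scalar G c) v"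
      unfolding mem_proj_class by blast
    then have "u (delta \<one>) = (\<lambda>x. c * v (delta \<one>) x)"
      using v' by (simp add: op_compose_apply op_scalar_apply)
    then show "cmod (ell2_inner G (u (delta \<one>)) (v (delta \<one>))) = 1"
      using c v' by (simp add: norm_mult ell2_inner_self)
  next
    assume 1: "cmod (ell2_inner G (u (delta \<one>)) (v (delta \<one>))) = 1"
    obtain c where c: "cmod c = 1" "ell2_norm G (\<lambda>x. c * u (delta \<one>) x - v (delta \<one>) x) = 0"
      using ell2_norm_phase_diff_attained[OF u'(1) v'(1) u'(2) v'(2)] 1 by auto
    then have "(\<lambda>x. c * u (delta \<one>) x - v (delta \<one>) x) = (\<lambda>x. 0)"
      using u' v' by (intro ell2_norm_eq_0 ell2_diff ell2_scale)
    then have "op_compose G (op_scalar G c) u (delta \<one>) = v (delta \<one>)"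
      using u' by (simp add: op_compose_apply op_scalar_apply fun_eq_iff)
    then have "op_compose G (op_scalar G c) u = v"
      using u v c by (intro vN_separating unitary_vN unitary_compose unitary_scalar)
    then have "v \<in> proj_class u"
      unfolding mem_proj_class using c(1) by auto
    then show "proj_class u = proj_class v"
      by (rule UG.repr_independence[OF _ u C])
  }
qed

text \<open>The distance of two classes is the distance of the unit vectors \<open>u \<delta>\<^sub>1\<close> and \<open>v \<delta>\<^sub>1\<close> up to a phase,
  so the triangle inequality follows by multiplying two optimal phases.\<close>

lemma proj_dist_metric: "Metric_space (carrier PU) (proj_dist G)"
proof
  fix A B :: "'a ell2_op set"
  show "0 \<le> proj_dist G A B"
  proof (cases "A \<in> carrier PU \<and> B \<in> carrier PU")
    case True
    then show ?thesis
      using overlap_le_1 by (auto simp: proj_carrier proj_dist_class)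
  next
    case False
    then show ?thesis by (auto simp: proj_dist_def)
  qed
  show "proj_dist G A B = proj_dist G B A"
  proof (cases "A \<in> carrier PU \<and> B \<in> carrier PU")
    case True
    then obtain u v where uv: "u \<in> carrier U" "v \<in> carrier U" "A = proj_class u" "B = proj_class v"
      by (auto simp: proj_carrier)
    have "cmod (ell2_inner G (u (delta \<one>)) (v (delta \<one>))) = cmod (ell2_inner G (v (delta \<one>)) (u (delta \<one>)))"
      by (subst ell2_inner_commute) simp
    then show ?thesis
      using uv by (simp add: proj_dist_class)
  next
    case False
    then show ?thesis by (auto simp: proj_dist_def)
  qed
  assume A: "A \<in> carrier PU" and B: "B \<in> carrier PU"
  then obtain u v where uv: "u \<in> carrier U" "v \<in> carrier U" "A = proj_class u" "B = proj_class v"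
    by (auto simp: proj_carrier)
  show "proj_dist G A B = 0 \<longleftrightarrow> A = B"
    using uv by (simp add: proj_dist_class proj_class_eq_iff)
  fix D assume "D \<in> carrier PU"
  then obtain w where w: "w \<in> carrier U" "D = proj_class w"
    by (auto simp: proj_carrier)
  note u' = unitary_delta_unit[OF uv(1)] and v' = unitary_delta_unit[OF uv(2)] and w' = unitary_delta_unit[OF w(1)]
  obtain c where c: "cmod c = 1"
    "ell2_norm G (\<lambda>x. c * u (delta \<one>) x - v (delta \<one>) x) = proj_dist G A B"
    using ell2_norm_phase_diff_attained[OF u'(1) v'(1) u'(2) v'(2)] uv by (auto simp: proj_dist_class)
  obtain d where d: "cmod d = 1"
    "ell2_norm G (\<lambda>x. d * v (delta \<one>) x - w (delta \<one>) x) = proj_dist G B D"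
    using ell2_norm_phase_diff_attained[OF v'(1) w'(1) v'(2) w'(2)] uv w by (auto simp: proj_dist_class)
  have "proj_dist G A D \<le> ell2_norm G (\<lambda>x. (d * c) * u (delta \<one>) x - w (delta \<one>) x)"
    using ell2_norm_phase_diff_ge[OF u'(1) w'(1) u'(2) w'(2), of "d * c"] uv w c d
    by (simp add: proj_dist_class norm_mult)
  also have "\<dots> \<le> ell2_norm G (\<lambda>x. (d * c) * u (delta \<one>) x - d * v (delta \<one>) x)
      + ell2_norm G (\<lambda>x. d * v (delta \<one>) x - w (delta \<one>) x)"
    by (intro ell2_norm_triangle_diff ell2_scale u' v' w')
  also have "(\<lambda>x. (d * c) * u (delta \<one>) x - d * v (delta \<one>) x) =
      (\<lambda>x. d * (c * u (delta \<one>) x - v (delta \<one>) x))"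
    by (simp add: algebra_simps)
  finally show "proj_dist G A D \<le> proj_dist G A B + proj_dist G B D"
    using c d by simp
qed

lemma vN_trace_norm_eq_1_iff:
  assumes u: "u \<in> carrier U"
  shows "cmod (vN_trace G u) = 1 \<longleftrightarrow> proj_class u = \<one>\<^bsub>PU\<^esub>"
proof -
  interpret h: group_hom U PU proj_class by (rule proj_class_hom)
  have "vN_trace G u = ell2_inner G (u (delta \<one>)) (op_scalar G 1 (delta \<one>))"
    by (simp add: vN_trace_def op_scalar_apply)
  then show ?thesis
    using proj_class_eq_iff[OF u unitary_scalar[of 1]] h.hom_one by simp
qed

lemma vN_trace_norm_le_1:
  assumes u: "u \<in> carrier U"
  shows "cmod (vN_trace G u) \<le> 1"
  using overlap_le_1[OF u unitary_scalar[of 1]] by (simp add: vN_trace_def op_scalar_apply)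

lemma proj_dist_class_trace:
  assumes u: "u \<in> carrier U" and v: "v \<in> carrier U"
  shows "proj_dist G (proj_class u) (proj_class v) =
    sqrt (2 - 2 * cmod (vN_trace G (inv\<^bsub>U\<^esub> u \<otimes>\<^bsub>U\<^esub> v)))"
proof -
  have "vN_trace G (inv\<^bsub>U\<^esub> u \<otimes>\<^bsub>U\<^esub> v) = ell2_inner G (v (delta \<one>)) (u (delta \<one>))"
    using u v by (simp add: unitary_inv vN_trace_adjoint_compose unitary_bounded)
  then have "cmod (vN_trace G (inv\<^bsub>U\<^esub> u \<otimes>\<^bsub>U\<^esub> v)) = cmod (ell2_inner G (u (delta \<one>)) (v (delta \<one>)))"
    by (subst ell2_inner_commute) simp
  then show ?thesis
    using u v by (simp only: proj_dist_class)
qed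

text \<open>The distance is invariant under left translation, so discreteness only concerns a neighbourhood
  of the identity; there, small distance means trace of absolute value close to 1.\<close>

lemma discrete_subgroup_iff_trace_gap:
  assumes L: "subgroup L PU"
  shows "discrete_subgroup L PU (proj_topology G) \<longleftrightarrow>
    (\<exists>r<1. \<forall>u\<in>carrier U. proj_class u \<in> L \<longrightarrow> proj_class u \<noteq> \<one>\<^bsub>PU\<^esub> \<longrightarrow> cmod (vN_trace G u) \<le> r)"
    (is "_ \<longleftrightarrow> ?gap")
proof -
  interpret M: Metric_space "carrier PU" "proj_dist G" by (rule proj_dist_metric)
  interpret h: group_hom U PU proj_class by (rule proj_class_hom)
  interpret L: subgroup L PU by (rule L)
  have "discrete_subgroup L PU (proj_topology G) \<longleftrightarrow> (\<forall>A\<in>L. openin (subtopology M.mtopology L) {A})"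
    using L L.subset by (auto simp: discrete_subgroup_def proj_topology_def eq_commute[of _ "discrete_topology L"]
        discrete_topology_unique)
  also have "\<dots> \<longleftrightarrow> ?gap"
  proof
    assume "\<forall>A\<in>L. openin (subtopology M.mtopology L) {A}"
    then obtain V where V: "openin M.mtopology V" "{\<one>\<^bsub>PU\<^esub>} = V \<inter> L"
      using L.one_closed unfolding openin_subtopology by blast
    then obtain e where e: "0 < e" "M.mball \<one>\<^bsub>PU\<^esub> e \<subseteq> V"
      unfolding M.openin_mtopology by blast
    have "cmod (vN_trace G u) \<le> 1 - e\<^sup>2 / 2"
      if u: "u \<in> carrier U" "proj_class u \<in> L" "proj_class u \<noteq> \<one>\<^bsub>PU\<^esub>" for u
    proof (rule ccontr)
      assume "\<not> cmod (vN_trace G u) \<le> 1 - e\<^sup>2 / 2"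
      then have "sqrt (2 - 2 * cmod (vN_trace G u)) < e"
        using e(1) by (intro real_less_lsqrt) auto
      then have "proj_dist G \<one>\<^bsub>PU\<^esub> (proj_class u) < e"
        using proj_dist_class_trace[OF h.G.one_closed u(1)]
        unfolding h.hom_one h.G.inv_one h.G.l_one[OF u(1)] by simp
      then have "proj_class u \<in> M.mball \<one>\<^bsub>PU\<^esub> e"
        unfolding M.in_mball using L.subset u(2) h.H.one_closed by blast
      then show False using e(2) V(2) u(2,3) by blast
    qed
    then show ?gap
      using e(1) by (intro exI[of _ "1 - e\<^sup>2 / 2"]) auto
  next
    assume ?gap
    then obtain r where r: "r < 1" "\<And>u. u \<in> carrier U \<Longrightarrow> proj_class u \<in> L \<Longrightarrow>
        proj_class u \<noteq> \<one>\<^bsub>PU\<^esub> \<Longrightarrow> cmod (vN_trace G u) \<le> r" by blast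
    show "\<forall>A\<in>L. openin (subtopology M.mtopology L) {A}"
    proof
      fix A assume A: "A \<in> L"
      define e where "e = sqrt (2 - 2 * r)"
      have e: "0 < e" using r(1) by (simp add: e_def)
      have "B = A" if B: "B \<in> L" "proj_dist G A B < e" for B
      proof (rule ccontr)
        assume "B \<noteq> A"
        have AB: "A \<in> carrier PU" "B \<in> carrier PU"
          using A B L.subset by blast+
        then obtain u v where uv: "u \<in> carrier U" "v \<in> carrier U" "A = proj_class u" "B = proj_class v"
          unfolding proj_carrier by blast
        define w where "w = inv\<^bsub>U\<^esub> u \<otimes>\<^bsub>U\<^esub> v"
        have w: "w \<in> carrier U" unfolding w_def using uv by (intro h.G.m_closed h.G.inv_closed)
        have cw: "proj_class w = inv\<^bsub>PU\<^esub> A \<otimes>\<^bsub>PU\<^esub> B"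
          unfolding w_def uv(3,4) using uv(1,2) by (simp only: h.hom_mult h.hom_inv h.G.inv_closed)
        have "proj_class w \<in> L"
          unfolding cw using A B by (intro L.m_closed L.m_inv_closed)
        moreover have "proj_class w \<noteq> \<one>\<^bsub>PU\<^esub>"
        proof
          assume "proj_class w = \<one>\<^bsub>PU\<^esub>"
          then have "inv\<^bsub>PU\<^esub> B = inv\<^bsub>PU\<^esub> A"
            unfolding cw using AB by (intro h.H.inv_equality h.H.inv_closed)
          then have "B = A"
            using AB by (metis h.H.inv_inv)
          then show False using \<open>B \<noteq> A\<close> by simp
        qed
        ultimately have "cmod (vN_trace G w) \<le> r"
          using r(2) w by blast
        then have "e \<le> proj_dist G A B"
          unfolding uv(3,4) proj_dist_class_trace[OF uv(1,2)] w_def[symmetric] e_def by simp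
        then show False using B by simp
      qed
      moreover have "A \<in> M.mball A e"
        using A L.subset e by (subst M.centre_in_mball_iff) blast
      moreover have "proj_dist G A B < e" if "B \<in> M.mball A e" for B
        using that unfolding M.in_mball by blast
      ultimately have "{A} = M.mball A e \<inter> L"
        using A by blast
      then show "openin (subtopology M.mtopology L) {A}"
        unfolding openin_subtopology using M.openin_mball[of A e] by blast
    qed
  qed
  finally show ?thesis .
qed

end

section \<open>Commutators with generic conjugates\<close>
text \<open>Replacing \<open>\<xi>\<close> first by its restriction to \<open>E\<close>, and then by its restriction to \<open>F\<close> in each of the
  finitely many terms \<open>\<xi>\<^sub>b J\<^sub>b \<xi>\<close> obtained, costs only 2-norms of the tails. The second error is
  multiplied by the 1-norm of the first restriction; hence \<open>E\<close> has to be chosen before \<open>F\<close>.\<close>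

lemma isometry_truncate_twice:
  assumes T: "T \<in> bounded_ops G" "\<And>f. f \<in> ell2 G \<Longrightarrow> ell2_norm G (T f) = ell2_norm G f"
    and \<xi>: "\<xi> \<in> ell2 G"
    and F: "finite E" "E \<subseteq> carrier G" "finite F" "F \<subseteq> carrier G"
    and J: "\<And>b. b \<in> E \<Longrightarrow> J b \<in> bounded_ops G"
      "\<And>b f. b \<in> E \<Longrightarrow> f \<in> ell2 G \<Longrightarrow> ell2_norm G (J b f) = ell2_norm G f"
    and TJ: "\<And>b. b \<in> E \<Longrightarrow> T (delta b) = J b \<xi>"
    and Jm: "\<And>a b. b \<in> E \<Longrightarrow> a \<in> F \<Longrightarrow> J b (delta a) = delta (m a b)"
  shows "ell2_norm G (\<lambda>x. T \<xi> x - (\<Sum>p\<in>E \<times> F. \<xi> (fst p) * \<xi> (snd p) * delta (m (snd p) (fst p)) x)) \<le>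
    ell2_norm G (\<lambda>x. \<xi> x - ell2_truncate E \<xi> x) +
    (\<Sum>b\<in>E. cmod (\<xi> b)) * ell2_norm G (\<lambda>x. \<xi> x - ell2_truncate F \<xi> x)"
proof -
  let ?x = "ell2_truncate E \<xi>" and ?y = "ell2_truncate F \<xi>"
  have xy: "?x \<in> ell2 G" "?y \<in> ell2 G"
    by (intro ell2_truncate_ell2 F)+
  have Tx: "T ?x = (\<lambda>x. \<Sum>b\<in>E. \<xi> b * J b \<xi> x)"
    unfolding ell2_truncate_def using F by (subst bounded_ops_sum[OF T(1)]) (auto simp: TJ)
  have Jy: "J b ?y = (\<lambda>x. \<Sum>a\<in>F. \<xi> a * delta (m a b) x)" if "b \<in> E" for b
    unfolding ell2_truncate_def using F that by (subst bounded_ops_sum[OF J(1)]) (auto simp: Jm)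
  have z: "(\<Sum>p\<in>E \<times> F. \<xi> (fst p) * \<xi> (snd p) * delta (m (snd p) (fst p)) x) = (\<Sum>b\<in>E. \<xi> b * J b ?y x)" for x
    by (simp add: Jy sum_distrib_left sum.cartesian_product case_prod_unfold mult.assoc)
  have Jd: "(\<lambda>x. J b \<xi> x - J b ?y x) \<in> ell2 G"
    "ell2_norm G (\<lambda>x. J b \<xi> x - J b ?y x) = ell2_norm G (\<lambda>x. \<xi> x - ?y x)" if b: "b \<in> E" for b
    unfolding bounded_ops_diff[OF J(1)[OF b] \<xi> xy(2), symmetric]
    using bounded_ops_closed[OF J(1)[OF b]] J(2)[OF b] ell2_diff(1)[OF \<xi> xy(2)] by auto
  have Jxi: "J b \<xi> \<in> ell2 G" "J b ?y \<in> ell2 G" if b: "b \<in> E" for b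
    using bounded_ops_closed[OF J(1)[OF b]] \<xi> xy by auto
  have "ell2_norm G (\<lambda>x. T \<xi> x - (\<Sum>b\<in>E. \<xi> b * J b ?y x)) \<le>
      ell2_norm G (\<lambda>x. T \<xi> x - T ?x x) + ell2_norm G (\<lambda>x. T ?x x - (\<Sum>b\<in>E. \<xi> b * J b ?y x))"
    by (intro ell2_norm_triangle_diff bounded_ops_closed[OF T(1)] \<xi> xy ell2_sum(1) ell2_scale Jxi)
  also have "ell2_norm G (\<lambda>x. T \<xi> x - T ?x x) = ell2_norm G (\<lambda>x. \<xi> x - ?x x)"
    unfolding bounded_ops_diff[OF T(1) \<xi> xy(1), symmetric] by (intro T(2) ell2_diff(1) \<xi> xy)
  also have "(\<lambda>x. T ?x x - (\<Sum>b\<in>E. \<xi> b * J b ?y x)) = (\<lambda>x. \<Sum>b\<in>E. \<xi> b * (J b \<xi> x - J b ?y x))"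
    by (simp add: Tx right_diff_distrib sum_subtractf)
  also have "ell2_norm G \<dots> \<le> (\<Sum>b\<in>E. ell2_norm G (\<lambda>x. \<xi> b * (J b \<xi> x - J b ?y x)))"
    by (intro ell2_sum(2) ell2_scale Jd)
  also have "\<dots> = (\<Sum>b\<in>E. cmod (\<xi> b)) * ell2_norm G (\<lambda>x. \<xi> x - ?y x)"
    by (simp add: Jd sum_distrib_right)
  finally show ?thesis
    unfolding z by simp
qed

text \<open>Under the collision hypothesis, the coinciding pairs of terms form two families, each contributing
  \<open>|\<xi>\<^sub>e|\<^sup>2 \<Sum>|\<xi>\<^sub>b|\<^sup>2\<close>, which overlap in the single term \<open>|\<xi>\<^sub>e|\<^sup>4\<close>. This is a truncated form of the
  free-probability formula for the trace of a commutator of two free unitaries.\<close>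

lemma inner_of_sums_without_collisions:
  fixes \<xi> :: "'a \<Rightarrow> complex"
  assumes F: "finite F" "F \<subseteq> carrier G" "E \<subseteq> F" "e \<in> E"
    and mn: "\<And>a b. a \<in> F \<Longrightarrow> b \<in> E \<Longrightarrow> m a b \<in> carrier G" "\<And>a b. a \<in> F \<Longrightarrow> b \<in> E \<Longrightarrow> n a b \<in> carrier G"
    and collide: "\<And>a b c d. a \<in> F \<Longrightarrow> b \<in> E \<Longrightarrow> c \<in> F \<Longrightarrow> d \<in> E \<Longrightarrow>
      m a b = n c d \<longleftrightarrow> a = e \<and> d = e \<and> b = c \<or> b = e \<and> c = e \<and> a = d"
  shows "ell2_inner G (\<lambda>x. \<Sum>p\<in>E \<times> F. \<xi> (fst p) * \<xi> (snd p) * delta (m (snd p) (fst p)) x)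
      (\<lambda>x. \<Sum>p\<in>E \<times> F. \<xi> (fst p) * \<xi> (snd p) * delta (n (snd p) (fst p)) x) =
    of_real (2 * (cmod (\<xi> e))\<^sup>2 * (\<Sum>b\<in>E. (cmod (\<xi> b))\<^sup>2) - ((cmod (\<xi> e))\<^sup>2)\<^sup>2)"
proof -
  have E: "finite E" using F finite_subset by blast
  define t where "t = (\<lambda>p. \<xi> (fst p) * \<xi> (snd p))"
  define \<mu> where "\<mu> = (\<lambda>p. m (snd p) (fst p))"
  define \<nu> where "\<nu> = (\<lambda>p. n (snd p) (fst p))"
  define Q where "Q = {q \<in> (E \<times> F) \<times> (E \<times> F). \<mu> (fst q) = \<nu> (snd q)}"
  \<comment> \<open>the two families of coincidences that hold identically\<close>
  define QA where "QA = (\<lambda>b. ((b, e), (e, b))) ` E"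
  define QB where "QB = (\<lambda>a. ((e, a), (a, e))) ` E"
  define s where "s q = t (fst q) * cnj (t (snd q))" for q
  have carr: "\<mu> p \<in> carrier G" "\<nu> p \<in> carrier G" if "p \<in> E \<times> F" for p
    using that mn by (auto simp: \<mu>_def \<nu>_def)
  have in_ell2: "(\<lambda>x. t p * delta (\<mu> p) x) \<in> ell2 G" "(\<lambda>x. t p * delta (\<nu> p) x) \<in> ell2 G"
    if "p \<in> E \<times> F" for p
    using carr[OF that] by simp_all
  have "ell2_inner G (\<lambda>x. \<Sum>p\<in>E \<times> F. t p * delta (\<mu> p) x) (\<lambda>x. \<Sum>p\<in>E \<times> F. t p * delta (\<nu> p) x) =
      (\<Sum>p\<in>E \<times> F. ell2_inner G (\<lambda>x. t p * delta (\<mu> p) x) (\<lambda>x. \<Sum>q\<in>E \<times> F. t q * delta (\<nu> q) x))"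
    by (rule ell2_inner_sum_left[OF in_ell2(1) ell2_sum(1)[OF in_ell2(2)]])
  also have "\<dots> = (\<Sum>p\<in>E \<times> F. \<Sum>q\<in>E \<times> F. ell2_inner G (\<lambda>x. t p * delta (\<mu> p) x) (\<lambda>x. t q * delta (\<nu> q) x))"
    by (rule sum.cong[OF refl ell2_inner_sum_right[OF in_ell2(2) in_ell2(1)]])
  also have "\<dots> = (\<Sum>p\<in>E \<times> F. \<Sum>q\<in>E \<times> F. if \<mu> p = \<nu> q then t p * cnj (t q) else 0)"
    by (intro sum.cong refl) (auto simp: carr)
  also have "\<dots> = (\<Sum>q\<in>(E \<times> F) \<times> (E \<times> F). if \<mu> (fst q) = \<nu> (snd q) then s q else 0)"
    unfolding sum.cartesian_product case_prod_unfold s_def ..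
  also have "\<dots> = sum s Q"
    unfolding Q_def using E F by (intro sum.inter_filter[symmetric]) auto
  also have "Q = QA \<union> QB"
  proof -
    have "q \<in> Q \<longleftrightarrow> q \<in> QA \<union> QB" for q
    proof -
      obtain b a d c where q: "q = ((b, a), (d, c))" by (metis prod.collapse)
      show ?thesis
      proof (cases "b \<in> E \<and> a \<in> F \<and> d \<in> E \<and> c \<in> F")
        case True
        then show ?thesis
          using collide[of a b c d] by (auto simp: q Q_def QA_def QB_def \<mu>_def \<nu>_def)
      next
        case False
        then show ?thesis
          using F by (auto simp: q Q_def QA_def QB_def)
      qed
    qed
    then show ?thesis by blast
  qed
  also have "sum s (QA \<union> QB) = sum s QA + sum s QB - sum s (QA \<inter> QB)"
    using E sum.union_inter[of QA QB s] by (simp add: QA_def QB_def algebra_simps)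
  also have "QA \<inter> QB = {((e, e), (e, e))}"
    using F(4) by (auto simp: QA_def QB_def)
  also have "sum s QA = (\<Sum>b\<in>E. s ((b, e), (e, b)))"
    unfolding QA_def by (subst sum.reindex) (auto simp: inj_on_def)
  also have "sum s QB = (\<Sum>b\<in>E. s ((e, b), (b, e)))"
    unfolding QB_def by (subst sum.reindex) (auto simp: inj_on_def)
  also have "(\<Sum>b\<in>E. s ((b, e), (e, b))) = of_real ((cmod (\<xi> e))\<^sup>2 * (\<Sum>b\<in>E. (cmod (\<xi> b))\<^sup>2))"
    unfolding of_real_mult of_real_sum complex_norm_square sum_distrib_left
    by (simp add: s_def t_def mult_ac)
  also have "(\<Sum>b\<in>E. s ((e, b), (b, e))) = of_real ((cmod (\<xi> e))\<^sup>2 * (\<Sum>b\<in>E. (cmod (\<xi> b))\<^sup>2))"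
    unfolding of_real_mult of_real_sum complex_norm_square sum_distrib_left
    by (simp add: s_def t_def mult_ac)
  also have "sum s {((e, e), (e, e))} = of_real (((cmod (\<xi> e))\<^sup>2)\<^sup>2)"
    unfolding power2_eq_square[of "(cmod (\<xi> e))\<^sup>2"] of_real_mult complex_norm_square
    by (simp add: s_def t_def mult_ac)
  finally show ?thesis
    by (simp add: t_def \<mu>_def \<nu>_def)
qed

lemma inner_approx:
  assumes "w1 \<in> ell2 G" "w2 \<in> ell2 G" "z1 \<in> ell2 G" "z2 \<in> ell2 G"
    and "ell2_norm G w1 = 1" "ell2_norm G w2 = 1"
    and "ell2_norm G (\<lambda>x. w1 x - z1 x) \<le> \<eta>" "ell2_norm G (\<lambda>x. w2 x - z2 x) \<le> \<eta>" "\<eta> \<le> 1"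
  shows "cmod (ell2_inner G w1 w2 - ell2_inner G z1 z2) \<le> 3 * \<eta>"
proof -
  have \<eta>: "0 \<le> \<eta>" using assms(7) ell2_norm_nonneg order_trans by blast
  have "ell2_norm G z1 \<le> ell2_norm G w1 + ell2_norm G (\<lambda>x. w1 x - z1 x)"
    using ell2_diff(2)[OF assms(1) ell2_diff(1)[OF assms(1,3)]] by simp
  then have z1: "ell2_norm G z1 \<le> 2" using assms by linarith
  have "ell2_inner G w1 w2 - ell2_inner G z1 z2 =
      ell2_inner G (\<lambda>x. w1 x - z1 x) w2 + ell2_inner G z1 (\<lambda>x. w2 x - z2 x)"
    using assms(1-4) by (simp add: ell2_inner_diff_left ell2_inner_diff_right)
  also have "cmod \<dots> \<le> cmod (ell2_inner G (\<lambda>x. w1 x - z1 x) w2) + cmod (ell2_inner G z1 (\<lambda>x. w2 x - z2 x))"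
    by (rule norm_triangle_ineq)
  also have "\<dots> \<le> ell2_norm G (\<lambda>x. w1 x - z1 x) * ell2_norm G w2 +
      ell2_norm G z1 * ell2_norm G (\<lambda>x. w2 x - z2 x)"
    by (intro add_mono ell2_Cauchy_Schwarz ell2_diff assms(1-4))
  also have "\<dots> \<le> \<eta> * 1 + 2 * \<eta>"
    using assms z1 \<eta> by (intro add_mono mult_mono) auto
  finally show ?thesis by simp
qed

context group begin

text \<open>Write \<open>\<lambda>\<close> for the left regular representation. As \<open>v\<close> commutes with right translations, the vectors
  \<open>v \<lambda>\<^sub>g v \<lambda>\<^sub>g\<inverse> \<delta>\<^sub>1\<close> and \<open>\<lambda>\<^sub>g v \<lambda>\<^sub>g\<inverse> \<xi>\<close> are isometric images of \<open>\<xi>\<close>. Up to errors that do not depend on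
  \<open>g\<close> they are finite combinations of the point masses at \<open>a g b g\<inverse>\<close> and at \<open>g c g\<inverse> d\<close>, respectively,
  with \<open>b, d \<in> E\<close> and \<open>a, c \<in> F\<close>. Only then is \<open>g\<close> chosen, so as to avoid collisions.\<close>

lemma conjugate_commutator_inner_approx:
  assumes mif: "mixed_identity_free G" and v: "v \<in> carrier U" and \<epsilon>: "0 < \<epsilon>"
  defines "\<xi> \<equiv> v (delta \<one>)"
  defines "p \<equiv> (cmod (\<xi> \<one>))\<^sup>2"
  obtains g where "g \<in> carrier G"
    "cmod (ell2_inner G (v (left_regular G g (v (left_regular G (inv g) (delta \<one>)))))
       (left_regular G g (v (left_regular G (inv g) \<xi>))) - of_real (2 * p - p\<^sup>2)) \<le> \<epsilon>"
proof -
  define \<eta> where "\<eta> = min 1 (\<epsilon> / 5)"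
  have \<eta>: "0 < \<eta>" "\<eta> \<le> 1" "5 * \<eta> \<le> \<epsilon>" using \<epsilon> by (auto simp: \<eta>_def)
  note vb = unitary_bounded[OF v] and vv = unitary_vN[OF v]
  note \<xi> = unitary_delta_unit[OF v, folded \<xi>_def]
  have "0 < \<eta> / 2" using \<eta> by simp
  then obtain E0 where E0: "finite E0" "E0 \<subseteq> carrier G"
    "\<And>F'. finite F' \<Longrightarrow> E0 \<subseteq> F' \<Longrightarrow> F' \<subseteq> carrier G \<Longrightarrow>
       ell2_norm G (\<lambda>x. \<xi> x - ell2_truncate F' \<xi> x) \<le> \<eta> / 2"
    by (rule ell2_truncate_approx[OF \<xi>(1)]) blast
  \<comment> \<open>both families of coincidences involve the coefficient of \<open>\<xi>\<close> at the identity\<close>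
  define E where "E = insert \<one> E0"
  have E: "finite E" "E \<subseteq> carrier G" "\<one> \<in> E" "ell2_norm G (\<lambda>x. \<xi> x - ell2_truncate E \<xi> x) \<le> \<eta> / 2"
    using E0(1,2) E0(3)[of E] by (auto simp: E_def)
  define M where "M = (\<Sum>b\<in>E. cmod (\<xi> b))"
  have M: "0 \<le> M" by (simp add: M_def sum_nonneg)
  have "0 < \<eta> / (2 * (M + 1))" using \<eta> M by simp
  then obtain F0 where F0: "finite F0" "F0 \<subseteq> carrier G"
    "\<And>F'. finite F' \<Longrightarrow> F0 \<subseteq> F' \<Longrightarrow> F' \<subseteq> carrier G \<Longrightarrow>
       ell2_norm G (\<lambda>x. \<xi> x - ell2_truncate F' \<xi> x) \<le> \<eta> / (2 * (M + 1))"
    by (rule ell2_truncate_approx[OF \<xi>(1)]) blast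
  define F where "F = E \<union> F0"
  have F: "finite F" "F \<subseteq> carrier G" "E \<subseteq> F" "ell2_norm G (\<lambda>x. \<xi> x - ell2_truncate F \<xi> x) \<le> \<eta> / (2 * (M + 1))"
    using E F0(1,2) F0(3)[of F] by (auto simp: F_def)
  have "M * ell2_norm G (\<lambda>x. \<xi> x - ell2_truncate F \<xi> x) \<le> (M + 1) * (\<eta> / (2 * (M + 1)))"
    using M F(4) by (intro mult_mono) auto
  also have "\<dots> = \<eta> / 2" using M by (simp add: divide_simps)
  finally have err: "ell2_norm G (\<lambda>x. \<xi> x - ell2_truncate E \<xi> x) +
      M * ell2_norm G (\<lambda>x. \<xi> x - ell2_truncate F \<xi> x) \<le> \<eta>"
    using E(4) by simp
  obtain g where g: "g \<in> carrier G"
    "\<And>a b c d. a \<in> F \<Longrightarrow> b \<in> F \<Longrightarrow> c \<in> F \<Longrightarrow> d \<in> F \<Longrightarrow>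
       a \<otimes> g \<otimes> b \<otimes> inv g = g \<otimes> c \<otimes> inv g \<otimes> d \<longleftrightarrow>
       a = \<one> \<and> d = \<one> \<and> b = c \<or> b = \<one> \<and> c = \<one> \<and> a = d"
    by (rule mixed_identity_free_avoid_collisions[OF mif F(1,2)]) blast
  let ?l = "left_regular G g" and ?l' = "left_regular G (inv g)"
  have lb: "?l \<in> bounded_ops G" "?l' \<in> bounded_ops G" "right_regular (inv g) \<in> bounded_ops G"
    using g(1) by (auto intro: left_regular_bounded right_regular_bounded)
  note ap = op_compose_apply
  have closed: "?l f \<in> ell2 G" "?l' f \<in> ell2 G" "right_regular (inv g) f \<in> ell2 G" "v f \<in> ell2 G"
    if "f \<in> ell2 G" for f
    using bounded_ops_closed[OF lb(1) that] bounded_ops_closed[OF lb(2) that]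
      bounded_ops_closed[OF lb(3) that] bounded_ops_closed[OF vb that] by auto
  have norms: "ell2_norm G (?l f) = ell2_norm G f" "ell2_norm G (?l' f) = ell2_norm G f"
    "ell2_norm G (right_regular (inv g) f) = ell2_norm G f" "ell2_norm G (v f) = ell2_norm G f"
    if "f \<in> ell2 G" for f
    using g(1) that by (auto simp: left_regular_norm right_regular_norm unitary_norm[OF v])
  have v_delta: "v (delta a) = right_regular a \<xi>" if "a \<in> carrier G" for a
    unfolding \<xi>_def by (rule vN_delta[OF vv that])
  define T where "T = op_compose G v (op_compose G ?l (right_regular (inv g)))"
  define S where "S = op_compose G ?l (op_compose G v ?l')"
  define w1 where "w1 = v (?l (v (?l' (delta \<one>))))"
  define w2 where "w2 = ?l (v (?l' \<xi>))"
  define z1 where "z1 = (\<lambda>x. \<Sum>q\<in>E \<times> F. \<xi> (fst q) * \<xi> (snd q) * delta (snd q \<otimes> g \<otimes> fst q \<otimes> inv g) x)"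
  define z2 where "z2 = (\<lambda>x. \<Sum>q\<in>E \<times> F. \<xi> (fst q) * \<xi> (snd q) * delta (g \<otimes> snd q \<otimes> inv g \<otimes> fst q) x)"
  have "v (?l' (delta \<one>)) = right_regular (inv g) \<xi>"
    using g(1) by (simp add: left_regular_delta v_delta)
  then have T\<xi>: "T \<xi> = w1"
    using \<xi>(1) by (simp add: T_def w1_def ap closed)
  have S\<xi>: "S \<xi> = w2"
    using \<xi>(1) by (simp add: S_def w2_def ap closed)
  have 1: "ell2_norm G (\<lambda>x. w1 x - z1 x) \<le> \<eta>"
  proof -
    have "ell2_norm G (\<lambda>x. T \<xi> x -
        (\<Sum>q\<in>E \<times> F. \<xi> (fst q) * \<xi> (snd q) * delta ((\<lambda>a b. a \<otimes> g \<otimes> b \<otimes> inv g) (snd q) (fst q)) x)) \<le>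
      ell2_norm G (\<lambda>x. \<xi> x - ell2_truncate E \<xi> x) +
      (\<Sum>b\<in>E. cmod (\<xi> b)) * ell2_norm G (\<lambda>x. \<xi> x - ell2_truncate F \<xi> x)"
    proof (rule isometry_truncate_twice[where J = "\<lambda>b. right_regular (g \<otimes> b \<otimes> inv g)"])
      show "T \<in> bounded_ops G"
        unfolding T_def by (intro op_compose_bounded vb lb)
      show "ell2_norm G (T f) = ell2_norm G f" if "f \<in> ell2 G" for f
        using that by (simp add: T_def ap closed norms)
      show "T (delta b) = right_regular (g \<otimes> b \<otimes> inv g) \<xi>" if "b \<in> E" for b
      proof -
        have "b \<in> carrier G" using that E by blast
        then show ?thesis
          using g(1) by (simp add: T_def ap closed right_regular_delta left_regular_delta v_delta m_assoc)
      qed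
    qed (use E F g(1) \<xi>(1) in \<open>auto intro!: right_regular_bounded right_regular_norm
        simp: right_regular_delta m_assoc subset_iff\<close>)
    then show ?thesis
      using err by (simp add: T\<xi> z1_def M_def)
  qed
  have 2: "ell2_norm G (\<lambda>x. w2 x - z2 x) \<le> \<eta>"
  proof -
    have "ell2_norm G (\<lambda>x. S \<xi> x -
        (\<Sum>q\<in>E \<times> F. \<xi> (fst q) * \<xi> (snd q) * delta ((\<lambda>c d. g \<otimes> c \<otimes> inv g \<otimes> d) (snd q) (fst q)) x)) \<le>
      ell2_norm G (\<lambda>x. \<xi> x - ell2_truncate E \<xi> x) +
      (\<Sum>b\<in>E. cmod (\<xi> b)) * ell2_norm G (\<lambda>x. \<xi> x - ell2_truncate F \<xi> x)"
    proof (rule isometry_truncate_twice[where J = "\<lambda>d. op_compose G ?l (right_regular (inv g \<otimes> d))"])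
      show "S \<in> bounded_ops G"
        unfolding S_def by (intro op_compose_bounded vb lb)
      show "ell2_norm G (S f) = ell2_norm G f" if "f \<in> ell2 G" for f
        using that by (simp add: S_def ap closed norms)
      fix d assume "d \<in> E"
      then have d: "d \<in> carrier G" "inv g \<otimes> d \<in> carrier G" using E g(1) by auto
      note rb = right_regular_bounded[OF d(2)]
      show "op_compose G ?l (right_regular (inv g \<otimes> d)) \<in> bounded_ops G"
        by (intro op_compose_bounded lb rb)
      show "ell2_norm G (op_compose G ?l (right_regular (inv g \<otimes> d)) f) = ell2_norm G f"
        if "f \<in> ell2 G" for f
        using that bounded_ops_closed[OF rb that] d by (simp add: ap norms right_regular_norm)
      show "S (delta d) = op_compose G ?l (right_regular (inv g \<otimes> d)) \<xi>"
        using d g(1) \<xi>(1) by (simp add: S_def ap closed left_regular_delta v_delta)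
      show "op_compose G ?l (right_regular (inv g \<otimes> d)) (delta c) = delta (g \<otimes> c \<otimes> inv g \<otimes> d)"
        if "c \<in> F" for c
      proof -
        have "c \<in> carrier G" using that F by blast
        then show ?thesis
          using d g(1) by (simp add: ap right_regular_delta left_regular_delta m_assoc)
      qed
    qed (use E F \<xi>(1) in auto)
    then show ?thesis
      using err by (simp add: S\<xi> z2_def M_def)
  qed
  have mn: "a \<otimes> g \<otimes> b \<otimes> inv g \<in> carrier G" "g \<otimes> a \<otimes> inv g \<otimes> b \<in> carrier G"
    if "a \<in> F" "b \<in> E" for a b
    using that E F g(1) by (auto simp: subset_iff)
  have collide: "a \<otimes> g \<otimes> b \<otimes> inv g = g \<otimes> c \<otimes> inv g \<otimes> d \<longleftrightarrow>
      a = \<one> \<and> d = \<one> \<and> b = c \<or> b = \<one> \<and> c = \<one> \<and> a = d"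
    if "a \<in> F" "b \<in> E" "c \<in> F" "d \<in> E" for a b c d
    by (rule g(2)) (use that F(3) in blast)+
  have w: "w1 \<in> ell2 G" "w2 \<in> ell2 G" "ell2_norm G w1 = 1" "ell2_norm G w2 = 1"
    unfolding w1_def w2_def using \<xi> by (simp_all add: closed norms ell2_norm_delta)
  have z: "z1 \<in> ell2 G" "z2 \<in> ell2 G"
    unfolding z1_def z2_def using mn by (auto intro!: ell2_sum(1) ell2_scale delta_ell2(1))
  have "cmod (ell2_inner G w1 w2 - ell2_inner G z1 z2) \<le> 3 * \<eta>"
    by (rule inner_approx[OF w(1,2) z w(3,4) 1 2 \<eta>(2)])
  moreover have "cmod (ell2_inner G z1 z2 - of_real (2 * p - p\<^sup>2)) \<le> 2 * \<eta>"
  proof -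
    define s where "s = (\<Sum>b\<in>E. (cmod (\<xi> b))\<^sup>2)"
    have "ell2_inner G z1 z2 = of_real (2 * p * s - p\<^sup>2)"
      unfolding z1_def z2_def p_def s_def
      by (rule inner_of_sums_without_collisions[OF F(1,2,3) E(3), where m = "\<lambda>a b. a \<otimes> g \<otimes> b \<otimes> inv g"
            and n = "\<lambda>c d. g \<otimes> c \<otimes> inv g \<otimes> d", OF mn collide])
    then have "ell2_inner G z1 z2 - of_real (2 * p - p\<^sup>2) = of_real (- (2 * (p * (1 - s))))"
      by (simp add: algebra_simps)
    then have eq: "cmod (ell2_inner G z1 z2 - of_real (2 * p - p\<^sup>2)) = \<bar>2 * (p * (1 - s))\<bar>"
      by (simp only: norm_of_real abs_minus_cancel)
    have s1: "1 - s = (ell2_norm G (\<lambda>x. \<xi> x - ell2_truncate E \<xi> x))\<^sup>2"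
      using ell2_norm_diff_truncate[OF \<xi>(1) E(1,2)] \<xi>(2) by (simp add: s_def)
    have "(\<eta> / 2)\<^sup>2 \<le> \<eta>"
      using \<eta> by (simp add: power2_eq_square field_simps mult_left_le)
    moreover have "1 - s \<le> (\<eta> / 2)\<^sup>2"
      unfolding s1 using E(4) by (intro power_mono) auto
    ultimately have s2: "0 \<le> 1 - s" "1 - s \<le> \<eta>"
      unfolding s1 by auto
    have "0 \<le> p" "p \<le> 1"
      using norm_apply_le_ell2_norm[OF \<xi>(1), of \<one>] \<xi>(2) by (auto simp: p_def power_le_one)
    then have "0 \<le> p * (1 - s)" "p * (1 - s) \<le> 1 * \<eta>"
      using s2 mult_mono[of p 1 "1 - s" \<eta>] by auto
    then show ?thesis
      unfolding eq by simp
  qed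
  ultimately have "cmod (ell2_inner G w1 w2 - of_real (2 * p - p\<^sup>2)) \<le> 3 * \<eta> + 2 * \<eta>"
    by (rule norm_diff_triangle_le)
  then show ?thesis
    using that[OF g(1)] \<eta>(3) unfolding w1_def w2_def by simp
qed

end

section \<open>Discrete subgroups above the image of the group\<close>
context group begin

lemma vN_trace_inv:
  assumes u: "u \<in> carrier U"
  shows "vN_trace G (inv\<^bsub>U\<^esub> u) = cnj (vN_trace G u)"
proof -
  have "vN_trace G (inv\<^bsub>U\<^esub> u) = ell2_inner G (delta \<one>) (u (delta \<one>))"
    unfolding vN_trace_def unitary_inv[OF u]
    by (rule op_adjoint_inner_left[OF unitary_bounded[OF u]]) simp_all
  then show ?thesis
    by (simp add: vN_trace_def)
qed

text \<open>The element \<open>g\<close> makes \<open>k = \<lambda>\<^sub>g u \<lambda>\<^sub>g\<inverse>\<close> asymptotically free from \<open>u\<close>, and for free \<open>u\<close> and \<open>k\<close> with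
  equal trace \<open>\<tau>\<close> the commutator has trace \<open>1 - (1 - |\<tau>|\<^sup>2)\<^sup>2\<close>.\<close>

lemma conjugate_commutator_trace:
  assumes mif: "mixed_identity_free G" and u: "u \<in> carrier U" and \<epsilon>: "0 < \<epsilon>"
  obtains g where "g \<in> carrier G"
    "\<And>k. k = left_regular G g \<otimes>\<^bsub>U\<^esub> u \<otimes>\<^bsub>U\<^esub> inv\<^bsub>U\<^esub> (left_regular G g) \<Longrightarrow>
      cmod (vN_trace G (u \<otimes>\<^bsub>U\<^esub> k \<otimes>\<^bsub>U\<^esub> (inv\<^bsub>U\<^esub> u \<otimes>\<^bsub>U\<^esub> inv\<^bsub>U\<^esub> k)) -
        of_real (1 - (1 - (cmod (vN_trace G u))\<^sup>2)\<^sup>2)) \<le> \<epsilon>"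
proof -
  interpret UG: group U by (rule unitary_group_is_group)
  define v where "v = inv\<^bsub>U\<^esub> u"
  have v: "v \<in> carrier U" using u by (simp only: v_def UG.inv_closed)
  obtain g where g: "g \<in> carrier G"
    "cmod (ell2_inner G (v (left_regular G g (v (left_regular G (inv g) (delta \<one>)))))
       (left_regular G g (v (left_regular G (inv g) (v (delta \<one>))))) -
      of_real (2 * (cmod (v (delta \<one>) \<one>))\<^sup>2 - ((cmod (v (delta \<one>) \<one>))\<^sup>2)\<^sup>2)) \<le> \<epsilon>"
    by (rule conjugate_commutator_inner_approx[OF mif v \<epsilon>]) blast
  show ?thesis
  proof (rule that[OF g(1)])
    fix k assume k_def: "k = left_regular G g \<otimes>\<^bsub>U\<^esub> u \<otimes>\<^bsub>U\<^esub> inv\<^bsub>U\<^esub> (left_regular G g)"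
    define l where "l = left_regular G g"
    define l' where "l' = left_regular G (inv g)"
    have l: "l \<in> carrier U" "l' \<in> carrier U" "inv\<^bsub>U\<^esub> l = l'"
      using g(1) by (simp_all add: l_def l'_def unitary_left_regular unitary_inv left_regular_adjoint)
    have k: "k \<in> carrier U" "inv\<^bsub>U\<^esub> k = l \<otimes>\<^bsub>U\<^esub> (v \<otimes>\<^bsub>U\<^esub> l')"
      unfolding k_def l_def[symmetric] v_def l(3)[symmetric] using l(1,2) u
      by (simp_all only: UG.m_closed UG.inv_closed UG.inv_mult_group UG.inv_inv UG.m_assoc)
    \<comment> \<open>the commutator is \<open>A\<^sup>* B\<close>, so its trace is an inner product of two vectors\<close>
    define A where "A = inv\<^bsub>U\<^esub> k \<otimes>\<^bsub>U\<^esub> v"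
    define B where "B = v \<otimes>\<^bsub>U\<^esub> inv\<^bsub>U\<^esub> k"
    have AB: "A \<in> carrier U" "B \<in> carrier U"
      unfolding A_def B_def using k(1) v by (simp_all only: UG.m_closed UG.inv_closed)
    have "u \<otimes>\<^bsub>U\<^esub> k = inv\<^bsub>U\<^esub> A"
      unfolding A_def v_def using u k(1) by (simp only: UG.inv_mult_group UG.inv_inv UG.inv_closed)
    then have tr: "vN_trace G (u \<otimes>\<^bsub>U\<^esub> k \<otimes>\<^bsub>U\<^esub> B) = ell2_inner G (B (delta \<one>)) (A (delta \<one>))"
      using AB by (simp add: unitary_inv vN_trace_adjoint_compose unitary_bounded)
    have d: "v (delta \<one>) \<in> ell2 G" "l' (delta \<one>) \<in> ell2 G" "l' (v (delta \<one>)) \<in> ell2 G"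
      "delta \<one> \<in> ell2 G" "v (l' (delta \<one>)) \<in> ell2 G"
      using bounded_ops_closed[OF unitary_bounded[OF v]] bounded_ops_closed[OF unitary_bounded[OF l(2)]]
      by auto
    have AB\<delta>: "B (delta \<one>) = v (l (v (l' (delta \<one>))))" "A (delta \<one>) = l (v (l' (v (delta \<one>))))"
      unfolding A_def B_def k(2) unitary_simps using d by (simp_all add: op_compose_apply)
    have abs: "cmod (v (delta \<one>) \<one>) = cmod (vN_trace G u)"
      using vN_trace_inv[OF u] by (simp add: v_def vN_trace_eq)
    have square: "2 * q - q\<^sup>2 = 1 - (1 - q)\<^sup>2" for q :: real
      by (simp add: power2_eq_square algebra_simps)
    show "cmod (vN_trace G (u \<otimes>\<^bsub>U\<^esub> k \<otimes>\<^bsub>U\<^esub> (inv\<^bsub>U\<^esub> u \<otimes>\<^bsub>U\<^esub> inv\<^bsub>U\<^esub> k)) -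
        of_real (1 - (1 - (cmod (vN_trace G u))\<^sup>2)\<^sup>2)) \<le> \<epsilon>"
      using g(2) unfolding abs square v_def[symmetric] B_def[symmetric] tr AB\<delta> l_def l'_def .
  qed
qed

text \<open>A measure of the distance to the scalars for which the commutator estimate reads
  \<open>q \<mapsto> 1 - (1 - q\<^sup>2)\<^sup>2\<close>, up to an arbitrarily small error.\<close>

definition defect :: "'a ell2_op \<Rightarrow> real"
  where "defect u = 1 - (cmod (vN_trace G u))\<^sup>2"

lemma defect_nonneg: "u \<in> carrier U \<Longrightarrow> 0 \<le> defect u"
  using vN_trace_norm_le_1 by (simp add: defect_def power_le_one)

lemma defect_eq_0_iff:
  assumes "u \<in> carrier U"
  shows "defect u = 0 \<longleftrightarrow> proj_class u = \<one>\<^bsub>PU\<^esub>"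
  unfolding vN_trace_norm_eq_1_iff[OF assms, symmetric] defect_def
  using power2_eq_1_iff[of "cmod (vN_trace G u)"] norm_ge_zero[of "vN_trace G u"] by auto

text \<open>The commutator with a generic conjugate has trace within \<open>q\<^sup>2 / 2\<close> of \<open>1 - q\<^sup>2\<close>. Hence it is
  nontrivial, and its defect is at most \<open>3 q\<^sup>2\<close>, which is at most \<open>q / 2\<close> when \<open>q < 1 / 6\<close>.\<close>

lemma smaller_defect:
  assumes mif: "mixed_identity_free G" and L: "subgroup L PU"
    and GL: "proj_left_regular G ` carrier G \<subseteq> L"
    and u: "u \<in> carrier U" "proj_class u \<in> L" "0 < defect u" "defect u < 1 / 6"
  obtains w where "w \<in> carrier U" "proj_class w \<in> L" "0 < defect w" "defect w \<le> defect u / 2"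
proof -
  interpret h: group_hom U PU proj_class by (rule proj_class_hom)
  interpret L: subgroup L PU by (rule L)
  define q where "q = defect u"
  have q: "0 < q" "q < 1 / 6" using u by (simp_all add: q_def)
  have "0 < q\<^sup>2 / 2" using q by simp
  then obtain g where g: "g \<in> carrier G"
    "\<And>k. k = left_regular G g \<otimes>\<^bsub>U\<^esub> u \<otimes>\<^bsub>U\<^esub> inv\<^bsub>U\<^esub> (left_regular G g) \<Longrightarrow>
      cmod (vN_trace G (u \<otimes>\<^bsub>U\<^esub> k \<otimes>\<^bsub>U\<^esub> (inv\<^bsub>U\<^esub> u \<otimes>\<^bsub>U\<^esub> inv\<^bsub>U\<^esub> k)) -
        of_real (1 - (1 - (cmod (vN_trace G u))\<^sup>2)\<^sup>2)) \<le> q\<^sup>2 / 2"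
    by (rule conjugate_commutator_trace[OF mif u(1)]) blast
  define l where "l = left_regular G g"
  define k where "k = l \<otimes>\<^bsub>U\<^esub> u \<otimes>\<^bsub>U\<^esub> inv\<^bsub>U\<^esub> l"
  define w where "w = u \<otimes>\<^bsub>U\<^esub> k \<otimes>\<^bsub>U\<^esub> (inv\<^bsub>U\<^esub> u \<otimes>\<^bsub>U\<^esub> inv\<^bsub>U\<^esub> k)"
  have l: "l \<in> carrier U" "proj_class l \<in> L"
    using GL g(1) by (auto simp: l_def unitary_left_regular proj_left_regular_def)
  have k: "k \<in> carrier U" "proj_class k \<in> L"
    unfolding k_def using l u(1,2)
    by (simp_all only: h.hom_mult h.hom_inv h.G.m_closed h.G.inv_closed L.m_closed L.m_inv_closed)
  have w: "w \<in> carrier U" "proj_class w \<in> L"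
    unfolding w_def using k u(1,2)
    by (simp_all only: h.hom_mult h.hom_inv h.G.m_closed h.G.inv_closed L.m_closed L.m_inv_closed)
  define t where "t = cmod (vN_trace G w)"
  have "cmod (vN_trace G w - of_real (1 - q\<^sup>2)) \<le> q\<^sup>2 / 2"
    using g(2)[OF k_def[unfolded l_def]] by (simp only: w_def q_def defect_def)
  moreover have "q\<^sup>2 \<le> 1" using q by (simp add: power_le_one)
  then have "cmod (of_real (1 - q\<^sup>2)) = 1 - q\<^sup>2" by (simp only: norm_of_real)
  ultimately have t: "t \<le> 1 - q\<^sup>2 / 2" "1 - 3 / 2 * q\<^sup>2 \<le> t"
    using norm_triangle_ineq3[of "vN_trace G w" "of_real (1 - q\<^sup>2)"] unfolding t_def by linarith+
  have q2: "q\<^sup>2 \<le> q / 6" using q by (simp add: power2_eq_square)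
  have "t\<^sup>2 \<le> t"
    using t(1) by (simp add: t_def power2_eq_square mult_left_le vN_trace_norm_le_1[OF w(1)])
  moreover have "0 < q\<^sup>2" using q by simp
  ultimately have 1: "0 < defect w" using t(1) unfolding defect_def t_def[symmetric] by linarith
  have "1 - t\<^sup>2 = (1 - t) * (1 + t)" by (simp add: power2_eq_square algebra_simps)
  also have "\<dots> \<le> (3 / 2 * q\<^sup>2) * 2"
    using t \<open>0 < q\<^sup>2\<close> by (intro mult_mono) (auto simp: t_def)
  finally have "defect w \<le> q / 2" using q2 by (simp add: defect_def t_def)
  then show ?thesis
    using that[OF w 1] by (simp add: q_def)
qed

text \<open>The constant \<open>1 / 6\<close> is the same for all subgroups. This uniformity lets the condition pass to unions
  of chains, which fails for discreteness in general.\<close>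

definition gapped :: "'a ell2_op set set \<Rightarrow> bool"
  where "gapped L \<longleftrightarrow> (\<forall>u\<in>carrier U. proj_class u \<in> L \<longrightarrow> proj_class u \<noteq> \<one>\<^bsub>PU\<^esub> \<longrightarrow> 1 / 6 \<le> defect u)"

lemma gapped_discrete:
  assumes L: "subgroup L PU" "gapped L"
  shows "discrete_subgroup L PU (proj_topology G)"
  unfolding discrete_subgroup_iff_trace_gap[OF L(1)]
proof (intro exI[of _ "sqrt (5 / 6)"] conjI ballI impI)
  fix u assume "u \<in> carrier U" "proj_class u \<in> L" "proj_class u \<noteq> \<one>\<^bsub>PU\<^esub>"
  then have "(cmod (vN_trace G u))\<^sup>2 \<le> 5 / 6"
    using L(2) by (auto simp: gapped_def defect_def)
  then show "cmod (vN_trace G u) \<le> sqrt (5 / 6)"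
    by (rule real_le_rsqrt)
qed simp

text \<open>Otherwise repeated commutators would produce nontrivial elements of the subgroup with arbitrarily
  small defect.\<close>

lemma discrete_gapped:
  assumes mif: "mixed_identity_free G" and L: "discrete_subgroup L PU (proj_topology G)"
    and GL: "proj_left_regular G ` carrier G \<subseteq> L"
  shows "gapped L"
proof (rule ccontr)
  have sub: "subgroup L PU" using L by (simp add: discrete_subgroup_def)
  assume "\<not> gapped L"
  then obtain u where u: "u \<in> carrier U" "proj_class u \<in> L" "proj_class u \<noteq> \<one>\<^bsub>PU\<^esub>" "defect u < 1 / 6"
    by (auto simp: gapped_def not_le)
  then have u0: "0 < defect u"
    using defect_nonneg defect_eq_0_iff by (metis order_le_less)
  have small: "\<exists>w\<in>carrier U. proj_class w \<in> L \<and> 0 < defect w \<and> defect w \<le> defect u / 2 ^ n" for n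
  proof (induction n)
    case 0
    then show ?case using u u0 by (intro bexI[of _ u]) auto
  next
    case (Suc n)
    then obtain w where w: "w \<in> carrier U" "proj_class w \<in> L" "0 < defect w" "defect w \<le> defect u / 2 ^ n"
      by blast
    have "defect u / 2 ^ n \<le> defect u" using u0 by (simp add: divide_le_eq)
    then have "defect w < 1 / 6" using w(4) u(4) by linarith
    then obtain w' where "w' \<in> carrier U" "proj_class w' \<in> L" "0 < defect w'" "defect w' \<le> defect w / 2"
      by (rule smaller_defect[OF mif sub GL w(1-3)])
    then show ?case
      using w(4) by (intro bexI[of _ w']) auto
  qed
  \<comment> \<open>discreteness bounds the traces of nontrivial elements away from 1, hence their defects from 0\<close>
  obtain r where r: "r < 1" "\<forall>w\<in>carrier U. proj_class w \<in> L \<longrightarrow> proj_class w \<noteq> \<one>\<^bsub>PU\<^esub> \<longrightarrow>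
      cmod (vN_trace G w) \<le> r"
    using L unfolding discrete_subgroup_iff_trace_gap[OF sub] by blast
  obtain n where n: "defect u / 2 ^ n < 1 - r"
  proof -
    obtain n where "defect u / (1 - r) < 2 ^ n"
      using real_arch_pow[of 2] by auto
    then show ?thesis using that[of n] r(1) by (simp add: field_simps)
  qed
  obtain w where w: "w \<in> carrier U" "proj_class w \<in> L" "0 < defect w" "defect w \<le> defect u / 2 ^ n"
    using small by blast
  then have "cmod (vN_trace G w) \<le> r"
    using r(2) defect_eq_0_iff[OF w(1)] by auto
  moreover have "(cmod (vN_trace G w))\<^sup>2 \<le> cmod (vN_trace G w)"
    using vN_trace_norm_le_1[OF w(1)] by (simp add: power2_eq_square mult_left_le)
  ultimately show False
    using w(4) n by (simp add: defect_def)
qed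

lemma left_regular_hom: "left_regular G \<in> hom G U"
  by (rule homI) (auto simp: unitary_left_regular left_regular_mult)

lemma proj_left_regular_subgroup: "subgroup (proj_left_regular G ` carrier G) PU"
proof -
  interpret h: group_hom U PU proj_class by (rule proj_class_hom)
  interpret l: group_hom G U "left_regular G"
    by (intro group_hom.intro group_hom_axioms.intro left_regular_hom unitary_group_is_group is_group)
  have "subgroup (proj_class ` left_regular G ` carrier G) PU"
    by (intro h.subgroup_img_is_subgroup l.subgroup_img_is_subgroup subgroup_self)
  then show ?thesis
    by (simp add: image_image proj_left_regular_def)
qed

text \<open>Nontrivial group elements have trace 0, the largest possible defect.\<close>

lemma proj_left_regular_gapped: "gapped (proj_left_regular G ` carrier G)"
  unfolding gapped_def
proof (intro ballI impI)
  interpret h: group_hom U PU proj_class by (rule proj_class_hom)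
  fix u assume u: "u \<in> carrier U" "proj_class u \<in> proj_left_regular G ` carrier G" "proj_class u \<noteq> \<one>\<^bsub>PU\<^esub>"
  then obtain g where g: "g \<in> carrier G" "proj_class u = proj_class (left_regular G g)"
    by (auto simp: proj_left_regular_def)
  have "u \<in> proj_class (left_regular G g)"
    using group.rcos_self[OF unitary_group_is_group u(1) normal_imp_subgroup[OF circle_normal]] g(2) by simp
  then obtain c where c: "cmod c = 1" "u = op_compose G (op_scalar G c) (left_regular G g)"
    unfolding mem_proj_class by blast
  have "g \<noteq> \<one>"
  proof
    assume "g = \<one>"
    then have "proj_class u = proj_class \<one>\<^bsub>U\<^esub>"
      using g(2) by (simp add: left_regular_one)
    then show False using u(3) h.hom_one by simp
  qed
  have "u (delta \<one>) = (\<lambda>x. c * delta g x)"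
    using g(1) c(2) by (simp add: op_compose_apply op_scalar_apply left_regular_delta)
  then have "vN_trace G u = 0"
    using \<open>g \<noteq> \<one>\<close> by (simp add: vN_trace_eq)
  then show "1 / 6 \<le> defect u"
    by (simp add: defect_def)
qed

text \<open>Zorn's lemma for the gapped subgroups above the image of \<open>G\<close>. Every discrete overgroup of a
  maximal one contains the image of \<open>G\<close> as well, hence is gapped and belongs to the same family.\<close>

lemma maximal_discrete_overgroup:
  assumes mif: "mixed_identity_free G"
  shows "\<exists>L. maximal_discrete_subgroup L PU (proj_topology G) \<and> proj_left_regular G ` carrier G \<subseteq> L"
proof -
  interpret P: group PU by (rule proj_unitary_group_is_group)
  define \<A> where "\<A> = {L. subgroup L PU \<and> gapped L \<and> proj_left_regular G ` carrier G \<subseteq> L}"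
  have "\<exists>M\<in>\<A>. \<forall>X\<in>\<A>. M \<subseteq> X \<longrightarrow> X = M"
  proof (rule subset_Zorn_nonempty)
    show "\<A> \<noteq> {}"
      using proj_left_regular_subgroup proj_left_regular_gapped by (auto simp: \<A>_def)
    fix \<C> assume \<C>: "\<C> \<noteq> {}" "subset.chain \<A> \<C>"
    have sub: "subgroup L PU" "gapped L" "proj_left_regular G ` carrier G \<subseteq> L" if "L \<in> \<C>" for L
      using \<C>(2) that by (auto simp: subset.chain_def \<A>_def)
    have chain: "K \<subseteq> L \<or> L \<subseteq> K" if "K \<in> \<C>" "L \<in> \<C>" for K L
      using \<C>(2) that by (auto simp: subset_chain_def)
    have "subgroup (\<Union>\<C>) PU"
    proof (rule P.subgroupI)
      show "\<Union>\<C> \<subseteq> carrier PU"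
        using sub(1) subgroup.subset by blast
      show "\<Union>\<C> \<noteq> {}"
        using \<C>(1) sub(1) subgroup.one_closed by blast
      show "inv\<^bsub>PU\<^esub> A \<in> \<Union>\<C>" if A: "A \<in> \<Union>\<C>" for A
      proof -
        obtain L where L: "L \<in> \<C>" "A \<in> L" using A by blast
        show ?thesis
          using subgroup.m_inv_closed[OF sub(1)[OF L(1)] L(2)] L(1) by blast
      qed
      fix A B assume "A \<in> \<Union>\<C>" "B \<in> \<Union>\<C>"
      then obtain L where L: "L \<in> \<C>" "A \<in> L" "B \<in> L"
        using chain by blast
      show "A \<otimes>\<^bsub>PU\<^esub> B \<in> \<Union>\<C>"
        using subgroup.m_closed[OF sub(1)[OF L(1)] L(2,3)] L(1) by blast
    qed
    moreover have "gapped (\<Union>\<C>)"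
      using sub(2) unfolding gapped_def by blast
    moreover have "proj_left_regular G ` carrier G \<subseteq> \<Union>\<C>"
      using \<C>(1) sub(3) by blast
    ultimately show "\<Union>\<C> \<in> \<A>"
      by (simp add: \<A>_def)
  qed
  then obtain M where M: "M \<in> \<A>" "\<And>X. X \<in> \<A> \<Longrightarrow> M \<subseteq> X \<Longrightarrow> X = M"
    by blast
  have "\<not> M \<subset> L" if L: "discrete_subgroup L PU (proj_topology G)" for L
  proof
    assume less: "M \<subset> L"
    then have GL: "proj_left_regular G ` carrier G \<subseteq> L"
      using M(1) by (auto simp: \<A>_def)
    have "subgroup L PU"
      using L by (simp add: discrete_subgroup_def)
    then have "L \<in> \<A>"
      using discrete_gapped[OF mif L GL] GL by (simp add: \<A>_def)
    then show False using M(2) less by blast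
  qed
  moreover have "discrete_subgroup M PU (proj_topology G)"
    using M(1) gapped_discrete by (simp add: \<A>_def)
  ultimately show ?thesis
    using M(1) unfolding maximal_discrete_subgroup_def \<A>_def by blast
qed

end

theorem theorem3p5:
  fixes G :: "('a, 'm) monoid_scheme"
  assumes "group G"
    and "mixed_identity_free G"
  shows "\<exists>L. maximal_discrete_subgroup L (proj_unitary_group G) (proj_topology G) \<and>
             proj_left_regular G ` carrier G \<subseteq> L"
  by (rule group.maximal_discrete_overgroup[OF assms])

end
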